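(* Let $1\le k\le r$ and $\lambda\in\mathcal P_r$. Then $$\big(\boldsymbol\beta(w_k^{-1})\wedge\boldsymbol\beta(w_{k-1}^{-1})\wedge\cdots\wedge\boldsymbol\beta(w_1^{-1})\big)\lrcorner[\mathbf b]^r_\lambda=\frac{\Delta_0(\mathbf w_k)}{(w_1\cdots w_k)^{r-1}}\,\Gamma^*(\mathbf w_k)[\mathbf b]^r_\lambda,$$ where $\Delta_0(\mathbf w_k)=\prod_{1\le i<j\le k}(w_j-w_i)$ is the Vandermonde determinant.
   Context: $V=\bigoplus_{i\ge0}\mathbb Q b_i$, with the convention $b_i=0$ for $i<0$; its restricted dual is $V^*=\bigoplus_{j\ge0}\mathbb Q\beta_j$, $\beta_j(b_i)=\delta_{ij}$; $\boldsymbol\beta(w^{-1})=\sum_{j\ge0}\beta_jw^{-j}$. $\mathcal P_r$ is the set of partitions of length at most $r$ (padded by zeros). For $\lambda\in\mathcal P_r$, $[\mathbf b]^r_\lambda=b_{r-1+\lambda_1}\wedge\cdots\wedge b_{\lambda_r}\in\bigwedge^rV$; subscript $0$ denotes the empty partition; $\bigwedge^0V=\mathbb Q$, $[\mathbf b]^0_0=1$. $\mathbf w_k=(w_1,\dots,w_k)$ are formal variables. Contraction: for $\beta\in V^*$, $\beta\lrcorner(u_1\wedge\cdots\wedge u_r)=\sum_{j=1}^r(-1)^{j+1}\beta(u_j)\,u_1\wedge\cdots\wedge\widehat{u_j}\wedge\cdots\wedge u_r$ (extended linearly over Laurent series in formal variables). A product of covectors acts by iterated contraction: $(\alpha_k\wedge\cdots\wedge\alpha_1)\lrcorner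 u=\alpha_k\lrcorner(\alpha_{k-1}\lrcorner(\cdots(\alpha_1\lrcorner u)))$. The ring $B_m$: for $m\ge0$, $B_m=\mathbb Q[e_1,\dots,e_m]$, $E_m(z)=1-e_1z+\cdots+(-1)^me_mz^m$, and $H_m=(h_j)_{j\in\mathbb Z}$ is defined by $\sum_jh_jz^j=1/E_m(z)$. Let $\overline\sigma_+(z)=\sum_i(-1)^i\overline\sigma_iz^i:\bigwedge V\to\bigwedge V[[z]]$ be the unique $\mathbb Q$-linear map with $\overline\sigma_+(z)1=1$, $\overline\sigma_+(z)(u\wedge v)=\overline\sigma_+(z)u\wedge\overline\sigma_+(z)v$ and $\overline\sigma_+(z)b_j=b_j-b_{j+1}z$. Then $\bigwedge^mV$ is a $B_m$-module with $e_i$ acting as $\overline\sigma_i$; it is free of rank one on $[\mathbf b]^m_0$. The vertex operator $\Gamma^*(\mathbf w_k)$ is defined by $$\Gamma^*(\mathbf w_k)[\mathbf b]^r_\lambda=\big(\overline\sigma_+(\mathbf w_k)\Delta_\lambda(\sigma_-(\mathbf w_k)H_{r-k})\big)[\mathbf b]^{r-k}_0,$$ where $\sigma_-(\mathbf w_k)H_{r-k}$ is the sequence obtained from $H_{r-k}$ (in $B_{r-k}$) by applying successively the substitutions $\sigma_-(w)h_j=\sum_{i\ge0}h_{j-i}w^{-i}$ for $w=w_1,\dots,w_k$; $\Delta_\lambda(A)=\det(a_{\lambda_j-j+i})_{1\le i,j\le r}$ for a sequence $A=(a_j)_{j\in\mathbb Z}$; and $\overline\sigma_+(\mathbf w_k)=\overline\sigma_+(w_1)\cdots\overline\sigma_+(w_k)$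 acts on $B_{r-k}$ as multiplication by $\prod_{j=1}^kE_{r-k}(w_j)$. *)

theory Defs
  imports
    "HOL-Library.Poly_Mapping"
    "HOL-Library.Groups_Big_Fun"
    "HOL-Computational_Algebra.Formal_Power_Series"
    "HOL-Computational_Algebra.Polynomial_FPS"
    "Jordan_Normal_Form.Determinant"
begin

abbreviation lookup :: "('a \<Rightarrow>\<^sub>0 'b::zero) \<Rightarrow> 'a \<Rightarrow> 'b" where "lookup \<equiv> Poly_Mapping.lookup"
abbreviation single :: "'a \<Rightarrow> 'b \<Rightarrow> 'a \<Rightarrow>\<^sub>0 'b::zero" where "single \<equiv> Poly_Mapping.single"
abbreviation keys :: "('a \<Rightarrow>\<^sub>0 'b::zero) \<Rightarrow> 'a set" where "keys \<equiv> Poly_Mapping.keys"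

section \<open>The exterior algebra of a vector space with a countable basis\<close>

text \<open>Both \<open>V\<close> and its restricted dual \<open>V\<^sup>*\<close> are finitely supported functions: the unit vector
  \<open>single i 1\<close> stands for \<open>b\<^sub>i\<close> in \<open>V\<close> and for \<open>\<beta>\<^sub>i\<close> in \<open>V\<^sup>*\<close>.\<close>

type_synonym vec_V = "nat \<Rightarrow>\<^sub>0 rat"
type_synonym covec_V = "nat \<Rightarrow>\<^sub>0 rat"

definition pairing :: "covec_V \<Rightarrow> vec_V \<Rightarrow> rat" where
  "pairing \<beta> v = (\<Sum>i\<in>keys v. lookup \<beta> i * lookup v i)"

text \<open>Words under concatenation form the free monoid, so its monoid algebra over \<open>\<rat>\<close> is the
  tensor algebra of \<open>V\<close>.\<close>

datatype index_word = Word (letters: "nat list")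

instantiation index_word :: monoid_add
begin
definition zero_index_word :: index_word where "0 = Word []"
definition plus_index_word :: "index_word \<Rightarrow> index_word \<Rightarrow> index_word" where
  "x + y = Word (letters x @ letters y)"
instance
  by standard (simp_all add: zero_index_word_def plus_index_word_def)
end

type_synonym tensor = "index_word \<Rightarrow>\<^sub>0 rat"

definition tensor_of_vec :: "vec_V \<Rightarrow> tensor" where
  "tensor_of_vec v = (\<Sum>i\<in>keys v. single (Word [i]) (lookup v i))"

text \<open>The two-sided ideal generated by the squares \<open>v \<otimes> v\<close> of vectors.\<close>

inductive_set alt_ideal :: "tensor set" where
  zero: "0 \<in> alt_ideal"
| step: "x \<in> alt_ideal \<Longrightarrow> x + l * (tensor_of_vec v * tensor_of_vec v) * r \<in> alt_ideal"

lemma alt_ideal_add: "y \<in> alt_ideal \<Longrightarrow> x \<in> alt_ideal \<Longrightarrow> x + y \<in> alt_ideal"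
proof (induction y rule: alt_ideal.induct)
  case (step y l v r)
  then show ?case using alt_ideal.step[of "x + y" l v r] by (simp add: add.assoc)
qed simp

lemma alt_ideal_left: "x \<in> alt_ideal \<Longrightarrow> a * x \<in> alt_ideal"
proof (induction x rule: alt_ideal.induct)
  case (step x l v r)
  then show ?case using alt_ideal.step[of "a * x" "a * l" v r]
    by (simp add: algebra_simps)
qed (simp add: alt_ideal.zero)

lemma alt_ideal_right: "x \<in> alt_ideal \<Longrightarrow> x * a \<in> alt_ideal"
proof (induction x rule: alt_ideal.induct)
  case (step x l v r)
  then show ?case using alt_ideal.step[of "x * a" "l" v "r * a"]
    by (simp add: algebra_simps)
qed (simp add: alt_ideal.zero)

lemma alt_ideal_uminus: "x \<in> alt_ideal \<Longrightarrow> - x \<in> alt_ideal"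
  using alt_ideal_left[of x "-1"] by simp

lemma alt_ideal_diff: "x \<in> alt_ideal \<Longrightarrow> y \<in> alt_ideal \<Longrightarrow> x - y \<in> alt_ideal"
  using alt_ideal_add[of "- y" x] alt_ideal_uminus[of y] by simp

lemma sum_single_keys: "x = (\<Sum>k\<in>keys x. single k (lookup x k))"
proof (rule poly_mapping_eqI)
  fix k
  show "lookup x k = lookup (\<Sum>k\<in>keys x. single k (lookup x k)) k"
    by (auto simp: lookup_sum lookup_single when_def in_keys_iff sum.delta)
qed

lemma poly_mapping_sum_induct [case_names zero mono add]:
  assumes "P 0" "\<And>k c. P (single k c)" "\<And>x y. P x \<Longrightarrow> P y \<Longrightarrow> P (x + y)"
  shows "P (x :: 'a \<Rightarrow>\<^sub>0 'b::comm_monoid_add)"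
proof -
  have "P (\<Sum>k\<in>S. single k (lookup x k))" if "finite S" for S
    using that by induction (auto intro: assms)
  from this[of "keys x"] show ?thesis by (simp flip: sum_single_keys)
qed

lemma word_add_eq_0_iff: "(x :: index_word) + y = 0 \<longleftrightarrow> x = 0 \<and> y = 0"
  by (cases x; cases y) (auto simp: zero_index_word_def plus_index_word_def)

lemma tensor_lookup_mult_0: "lookup (x * y :: tensor) 0 = lookup x 0 * lookup y 0"
proof (induction x rule: poly_mapping_sum_induct)
  case (mono k c)
  show ?case
    by (induction y rule: poly_mapping_sum_induct)
      (auto simp: mult_single lookup_single when_def word_add_eq_0_iff lookup_add algebra_simps)
qed (simp_all add: lookup_add algebra_simps)

lemma alt_ideal_lookup_0: "x \<in> alt_ideal \<Longrightarrow> lookup x 0 = 0"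
proof (induction x rule: alt_ideal.induct)
  case (step x l v r)
  have "lookup (tensor_of_vec v) 0 = 0"
    by (auto simp: tensor_of_vec_def lookup_sum lookup_single zero_index_word_def intro!: sum.neutral)
  with step show ?case by (simp add: lookup_add tensor_lookup_mult_0)
qed simp

quotient_type exterior = tensor / "\<lambda>x y. x - y \<in> alt_ideal"
proof (rule equivpI)
  show "reflp (\<lambda>x y. x - y \<in> alt_ideal)" by (rule reflpI) (simp add: alt_ideal.zero)
  show "symp (\<lambda>x y. x - y \<in> alt_ideal)"
    by (rule sympI) (metis alt_ideal_uminus minus_diff_eq)
  show "transp (\<lambda>x y. x - y \<in> alt_ideal)"
  proof (rule transpI)
    fix x y z :: tensor
    assume "x - y \<in> alt_ideal" "y - z \<in> alt_ideal"
    from alt_ideal_add[OF this(2,1)] show "x - z \<in> alt_ideal" by simp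
  qed
qed

text \<open>The multiplication \<open>*\<close> of the ring \<open>exterior\<close> is the wedge product.\<close>

instantiation exterior :: ring_1
begin
lift_definition zero_exterior :: exterior is 0 .
lift_definition one_exterior :: exterior is 1 .
lift_definition plus_exterior :: "exterior \<Rightarrow> exterior \<Rightarrow> exterior" is "(+)"
proof -
  fix a b c d :: tensor
  assume "a - b \<in> alt_ideal" "c - d \<in> alt_ideal"
  from alt_ideal_add[OF this] show "a + c - (b + d) \<in> alt_ideal" by (simp add: algebra_simps)
qed
lift_definition uminus_exterior :: "exterior \<Rightarrow> exterior" is "uminus"
proof -
  fix a b :: tensor
  assume "a - b \<in> alt_ideal"
  from alt_ideal_uminus[OF this] show "- a - - b \<in> alt_ideal" by simp
qed
lift_definition minus_exterior :: "exterior \<Rightarrow> exterior \<Rightarrow> exterior" is "(-)"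
proof -
  fix a b c d :: tensor
  assume "a - b \<in> alt_ideal" "c - d \<in> alt_ideal"
  from alt_ideal_diff[OF this] show "a - c - (b - d) \<in> alt_ideal" by (simp add: algebra_simps)
qed
lift_definition times_exterior :: "exterior \<Rightarrow> exterior \<Rightarrow> exterior" is "(*)"
proof -
  fix a b c d :: tensor
  assume "a - b \<in> alt_ideal" "c - d \<in> alt_ideal"
  from alt_ideal_add[OF alt_ideal_right[OF this(1), of c] alt_ideal_left[OF this(2), of b]]
  show "a * c - b * d \<in> alt_ideal" by (simp add: algebra_simps)
qed
instance
proof
  show "(0::exterior) \<noteq> 1"
  proof transfer
    show "0 - 1 \<notin> alt_ideal"
      using alt_ideal_lookup_0[of "0 - 1"] by (auto simp: lookup_one)
  qed
qed (transfer; simp add: algebra_simps alt_ideal.zero)+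
end

lift_definition scale_ext :: "rat \<Rightarrow> exterior \<Rightarrow> exterior" is
  "\<lambda>c x. single 0 c * x"
  by (metis alt_ideal_left right_diff_distrib)

lift_definition vect :: "vec_V \<Rightarrow> exterior" is tensor_of_vec .

definition bvec :: "nat \<Rightarrow> exterior" where "bvec i = vect (single i 1)"

text \<open>Partitions of length at most \<open>r\<close>, padded by zeros to exactly \<open>r\<close> parts. List positions count
  from \<open>0\<close>, so \<open>\<lambda>\<^sub>j\<close> is \<open>lam ! (j - 1)\<close>.\<close>

definition partitions_le :: "nat \<Rightarrow> nat list set" where
  "partitions_le r = {lam. length lam = r \<and> sorted_wrt (\<ge>) lam}"

definition bwedge :: "nat \<Rightarrow> nat list \<Rightarrow> exterior" where
  "bwedge r lam = prod_list (map (\<lambda>j. bvec (r - 1 - j + lam ! j)) [0..<r])"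

abbreviation empty_partition :: "nat \<Rightarrow> nat list" where
  "empty_partition m \<equiv> replicate m 0"

text \<open>Contraction by a covector.\<close>

definition contract :: "covec_V \<Rightarrow> exterior \<Rightarrow> exterior" where
  "contract \<beta> = (THE d. Vector_Spaces.linear scale_ext scale_ext d \<and>
     (\<forall>us. d (prod_list (map vect us)) =
       (\<Sum>j<length us. scale_ext ((- 1) ^ j * pairing \<beta> (us ! j))
          (prod_list (map vect (take j us @ drop (Suc j) us))))))"

section \<open>The rings \<open>B\<^sub>m\<close> and their action on the exterior algebra\<close>

definition scale_ext_fps :: "rat \<Rightarrow> exterior fps \<Rightarrow> exterior fps" where
  "scale_ext_fps c f = fps_const (scale_ext c 1) * f"

definition sigma_plus :: "exterior \<Rightarrow> exterior fps" where
  "sigma_plus = (THE s. Vector_Spaces.linear scale_ext scale_ext_fps s \<and> s 1 = 1 \<and>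
     (\<forall>u v. s (u * v) = s u * s v) \<and>
     (\<forall>j. s (bvec j) = fps_const (bvec j) - fps_const (bvec (Suc j)) * fps_X))"

definition sigma_bar :: "nat \<Rightarrow> exterior \<Rightarrow> exterior" where
  "sigma_bar i u = (- 1) ^ i * fps_nth (sigma_plus u) i"

text \<open>Polynomials over \<open>\<rat>\<close> in the variables \<open>e\<^sub>1, e\<^sub>2, \<dots>\<close>. The ring \<open>B\<^sub>m\<close> is the subring of those
  in which only \<open>e\<^sub>1, \<dots>, e\<^sub>m\<close> occur; \<open>esym 0\<close> is the leading coefficient \<open>1\<close> of \<open>E\<^sub>m\<close>.\<close>

type_synonym epoly = "(nat \<Rightarrow>\<^sub>0 nat) \<Rightarrow>\<^sub>0 rat"

definition esym :: "nat \<Rightarrow> epoly" where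
  "esym i = (if i = 0 then 1 else single (single i 1) 1)"

definition Epoly :: "nat \<Rightarrow> epoly poly" where
  "Epoly m = (\<Sum>i\<le>m. Polynomial.monom ((- 1) ^ i * esym i) i)"

definition hseq :: "nat \<Rightarrow> int \<Rightarrow> epoly" where
  "hseq m j = (if j < 0 then 0 else fps_nth (fps_right_inverse (fps_of_poly (Epoly m)) 1) (nat j))"

text \<open>\<open>e\<^sub>i\<close> acts as \<open>sigma_bar i\<close>. The operators \<open>sigma_bar i\<close> commute (see \<open>sigma_bar_commute\<close>
  below), so their order in the action of a monomial is irrelevant.\<close>

definition monomial_act :: "(nat \<Rightarrow>\<^sub>0 nat) \<Rightarrow> exterior \<Rightarrow> exterior" where
  "monomial_act a u = foldr (\<lambda>i. sigma_bar i ^^ lookup a i) (sorted_list_of_set (keys a)) u"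

definition B_act :: "epoly \<Rightarrow> exterior \<Rightarrow> exterior" where
  "B_act p u = (\<Sum>a\<in>keys p. scale_ext (lookup p a) (monomial_act a u))"

section \<open>Laurent polynomials in the variables \<open>w\<^sub>i\<close>\<close>

text \<open>An exponent vector assigns to \<open>i\<close> the exponent of \<open>w\<^sub>i\<close>. All the series that occur in the
  vertex operator and in contractions of elements of the exterior algebra are Laurent polynomials.\<close>

type_synonym 'a laurent = "(nat \<Rightarrow>\<^sub>0 int) \<Rightarrow>\<^sub>0 'a"

definition lconst :: "'a::zero \<Rightarrow> 'a laurent" where
  "lconst c = single 0 c"

definition wpow :: "nat \<Rightarrow> int \<Rightarrow> 'a::zero_neq_one laurent" where
  "wpow i n = single (single i n) 1"

text \<open>The extension of a biadditive map of coefficients to Laurent polynomials.\<close>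

definition laurent_bilin ::
    "('a::zero \<Rightarrow> 'b::zero \<Rightarrow> 'c::comm_monoid_add) \<Rightarrow> 'a laurent \<Rightarrow> 'b laurent \<Rightarrow> 'c laurent" where
  "laurent_bilin f P U =
     (\<Sum>p\<in>keys P. \<Sum>q\<in>keys U. single (p + q) (f (lookup P p) (lookup U q)))"

abbreviation scale_laurent :: "rat laurent \<Rightarrow> exterior laurent \<Rightarrow> exterior laurent" where
  "scale_laurent \<equiv> laurent_bilin scale_ext"

abbreviation B_act_laurent :: "epoly laurent \<Rightarrow> exterior laurent \<Rightarrow> exterior laurent" where
  "B_act_laurent \<equiv> laurent_bilin B_act"

text \<open>Formal series in the \<open>w\<^sub>i\<close> with coefficients in \<open>V\<^sup>*\<close>, possibly with infinitely many nonzero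
  coefficients. The sum over all exponents in the contraction by such a series has only finitely many
  nonzero terms if the series is \<open>\<beta>(w\<^sub>i\<^sup>-\<^sup>1)\<close> (see \<open>finite_contract_beta_series\<close> below).\<close>

type_synonym covec_series = "(nat \<Rightarrow>\<^sub>0 int) \<Rightarrow> covec_V"

definition beta_series :: "nat \<Rightarrow> covec_series" where
  "beta_series i p =
     (if \<exists>j::nat. p = single i (- int j) then single (nat (- lookup p i)) 1 else 0)"

definition contract_series :: "covec_series \<Rightarrow> exterior laurent \<Rightarrow> exterior laurent" where
  "contract_series A U =
     Sum_any (\<lambda>p. \<Sum>q\<in>keys U. single (p + q) (contract (A p) (lookup U q)))"

text \<open>Contraction by the product \<open>\<alpha>\<^sub>k \<and> \<dots> \<and> \<alpha>\<^sub>1\<close>, given as the list \<open>[\<alpha>\<^sub>k, \<dots>, \<alpha>\<^sub>1]\<close>.\<close>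

definition contract_wedge :: "covec_series list \<Rightarrow> exterior laurent \<Rightarrow> exterior laurent" where
  "contract_wedge As U = foldr contract_series As U"

section \<open>The vertex operator \<open>\<Gamma>\<^sup>*\<close>\<close>

text \<open>The sum has only finitely many nonzero terms, because \<open>a\<^sub>j = 0\<close> for \<open>j < 0\<close> in the sequences
  to which it is applied (see \<open>sigma_minus_eq\<close> below).\<close>

definition sigma_minus :: "nat \<Rightarrow> (int \<Rightarrow> epoly laurent) \<Rightarrow> int \<Rightarrow> epoly laurent" where
  "sigma_minus i a j = Sum_any (\<lambda>n::nat. a (j - int n) * wpow i (- int n))"

definition sigma_minus_H :: "nat \<Rightarrow> nat \<Rightarrow> int \<Rightarrow> epoly laurent" where
  "sigma_minus_H k m = fold sigma_minus [1..<Suc k] (\<lambda>j. lconst (hseq m j))"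

definition Delta :: "nat \<Rightarrow> nat list \<Rightarrow> (int \<Rightarrow> 'a::comm_ring_1) \<Rightarrow> 'a" where
  "Delta r lam a = det (mat r r (\<lambda>(i, j). a (int (lam ! j) - int j + int i)))"

definition Elaurent :: "nat \<Rightarrow> nat \<Rightarrow> epoly laurent" where
  "Elaurent m i = poly (map_poly lconst (Epoly m)) (wpow i 1)"

definition Gamma_star_coeff :: "nat \<Rightarrow> nat \<Rightarrow> nat list \<Rightarrow> epoly laurent" where
  "Gamma_star_coeff k r lam =
     (\<Prod>i = 1..k. Elaurent (r - k) i) * Delta r lam (sigma_minus_H k (r - k))"

text \<open>The linear map \<open>\<Gamma>\<^sup>*(w\<^sub>1, \<dots>, w\<^sub>k)\<close> on the \<open>r\<close>-th exterior power, given by its values on the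
  basis vectors. Its values outside of this subspace are arbitrary.\<close>

definition Gamma_star :: "nat \<Rightarrow> nat \<Rightarrow> exterior \<Rightarrow> exterior laurent" where
  "Gamma_star k r = (SOME G. Vector_Spaces.linear scale_ext (\<lambda>c. scale_laurent (lconst c)) G \<and>
     (\<forall>lam\<in>partitions_le r. G (bwedge r lam) =
        B_act_laurent (Gamma_star_coeff k r lam)
          (lconst (bwedge (r - k) (empty_partition (r - k))))))"

definition vandermonde :: "nat \<Rightarrow> rat laurent" where
  "vandermonde k = (\<Prod>j = 1..k. \<Prod>i = 1..<j. wpow j 1 - wpow i 1)"

section \<open>Existence and uniqueness of the operators defined above\<close>

lemma scale_tensor_commute: "single 0 c * x = x * single 0 (c :: rat)" for x :: tensor
  by (induction x rule: poly_mapping_sum_induct) (auto simp: mult_single algebra_simps)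

lemma vector_space_scale_ext: "vector_space scale_ext"
proof
  fix a b :: rat and x y :: exterior
  show "scale_ext a (x + y) = scale_ext a x + scale_ext a y"
    by transfer (simp add: algebra_simps alt_ideal.zero)
  show "scale_ext (a + b) x = scale_ext a x + scale_ext b x"
    by transfer (simp add: algebra_simps alt_ideal.zero single_add)
  show "scale_ext a (scale_ext b x) = scale_ext (a * b) x"
    by transfer (simp add: mult_single alt_ideal.zero flip: mult.assoc)
  show "scale_ext 1 x = x"
    by transfer (simp add: alt_ideal.zero single_one)
qed

interpretation ext: vector_space scale_ext
  by (rule vector_space_scale_ext)

lemma scale_ext_mult_left: "scale_ext c x * y = scale_ext c (x * y)"
  by transfer (simp add: alt_ideal.zero mult.assoc)

lemma scale_ext_mult_right: "x * scale_ext c y = scale_ext c (x * y)"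
proof transfer
  fix x y :: tensor and c
  have "x * (single 0 c * y) = single 0 c * (x * y)"
    by (metis mult.assoc scale_tensor_commute)
  then show "x * (single 0 c * y) - single 0 c * (x * y) \<in> alt_ideal"
    by (simp add: alt_ideal.zero)
qed

lemma exterior_exhaust: obtains x where "u = abs_exterior x"
  by (induct u rule: exterior.abs_induct) blast

subsection \<open>Lifting maps from the tensor algebra\<close>

locale rat_algebra = vector_space scale
  for scale :: "rat \<Rightarrow> 'a::ring_1 \<Rightarrow> 'a" +
  assumes scale_mult_left: "scale c x * y = scale c (x * y)"
    and scale_mult_right: "x * scale c y = scale c (x * y)"
begin

definition lin_ext :: "(index_word \<Rightarrow> 'a) \<Rightarrow> tensor \<Rightarrow> 'a" where
  "lin_ext g x = (\<Sum>w\<in>keys x. scale (lookup x w) (g w))"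

lemma lin_ext_superset:
  assumes "finite K" "keys x \<subseteq> K"
  shows "lin_ext g x = (\<Sum>w\<in>K. scale (lookup x w) (g w))"
  unfolding lin_ext_def using assms by (intro sum.mono_neutral_left) (auto simp: in_keys_iff)

lemma lin_ext_0 [simp]: "lin_ext g 0 = 0"
  by (simp add: lin_ext_def)

lemma lin_ext_add: "lin_ext g (x + y) = lin_ext g x + lin_ext g y"
proof -
  let ?K = "keys x \<union> keys y"
  have "keys (x + y) \<subseteq> ?K" by (rule keys_add)
  then show ?thesis
    by (simp add: lin_ext_superset[of ?K] lookup_add scale_left_distrib sum.distrib)
qed

lemma lin_ext_single [simp]: "lin_ext g (single w c) = scale c (g w)"
  by (subst lin_ext_superset[of "{w}"]) (auto simp: lookup_single)

lemma lin_ext_scale: "lin_ext g (single 0 c * x) = scale c (lin_ext g x)"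
  by (induction x rule: poly_mapping_sum_induct)
    (auto simp: mult_single lin_ext_add scale_right_distrib algebra_simps)

lemma lin_ext_uminus: "lin_ext g (- x) = - lin_ext g x"
  using lin_ext_add[of g x "- x"] by (simp add: eq_neg_iff_add_eq_0 add.commute)

lemma lin_ext_diff: "lin_ext g (x - y) = lin_ext g x - lin_ext g y"
  using lin_ext_add[of g x "- y"] by (simp add: lin_ext_uminus)

lemma lin_ext_sum: "lin_ext g (sum f S) = (\<Sum>i\<in>S. lin_ext g (f i))"
  by (induction S rule: infinite_finite_induct) (auto simp: lin_ext_add)

lemma lin_ext_mult:
  assumes "\<And>v w. g (v + w) = g v * g w"
  shows "lin_ext g (x * y) = lin_ext g x * lin_ext g y"
proof (induction x rule: poly_mapping_sum_induct)
  case (mono k c)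
  show ?case
    by (induction y rule: poly_mapping_sum_induct)
      (auto simp: mult_single assms lin_ext_add algebra_simps scale_mult_left scale_mult_right)
qed (auto simp: lin_ext_add algebra_simps)

definition word_prod :: "(nat \<Rightarrow> 'a) \<Rightarrow> index_word \<Rightarrow> 'a" where
  "word_prod g w = prod_list (map g (letters w))"

lemma word_prod_0 [simp]: "word_prod g 0 = 1"
  by (simp add: word_prod_def zero_index_word_def)

lemma word_prod_add: "word_prod g (v + w) = word_prod g v * word_prod g w"
  by (simp add: word_prod_def plus_index_word_def)

lemma lin_ext_tensor_of_vec:
  "lin_ext (word_prod g) (tensor_of_vec v) = (\<Sum>i\<in>keys v. scale (lookup v i) (g i))"
  by (simp add: tensor_of_vec_def lin_ext_sum word_prod_def)

lemma lin_ext_alt_ideal: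
  assumes "\<And>v. (\<Sum>i\<in>keys v. scale (lookup v i) (g i)) * (\<Sum>i\<in>keys v. scale (lookup v i) (g i)) = 0"
    and "x \<in> alt_ideal"
  shows "lin_ext (word_prod g) x = 0"
  using assms(2)
  by induction (simp_all add: lin_ext_add lin_ext_mult word_prod_add lin_ext_tensor_of_vec assms(1))

lemma lift_exists:
  assumes "\<And>x. x \<in> alt_ideal \<Longrightarrow> lin_ext g x = 0"
  shows "\<exists>f. (\<forall>x. f (abs_exterior x) = lin_ext g x) \<and> Vector_Spaces.linear scale_ext scale f"
proof -
  define f where "f u = lin_ext g (rep_exterior u)" for u
  have f: "f (abs_exterior x) = lin_ext g x" for x
  proof -
    have "rep_exterior (abs_exterior x) - x \<in> alt_ideal"
      using Quotient3_rep_abs[OF Quotient3_exterior] by (simp add: alt_ideal.zero)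
    from assms[OF this] show ?thesis by (simp add: f_def lin_ext_diff)
  qed
  have "f (u + v) = f u + f v" for u v
    by (cases u rule: exterior_exhaust; cases v rule: exterior_exhaust) (simp add: plus_exterior.abs_eq f lin_ext_add)
  moreover have "f (scale_ext c u) = scale c (f u)" for c u
    by (cases u rule: exterior_exhaust) (simp add: scale_ext.abs_eq f lin_ext_scale)
  ultimately have "Vector_Spaces.linear scale_ext scale f"
    unfolding Vector_Spaces.linear_iff using vector_space_scale_ext vector_space_axioms by blast
  with f show ?thesis by blast
qed

lemma hom_exists:
  assumes "\<And>v. (\<Sum>i\<in>keys v. scale (lookup v i) (g i)) * (\<Sum>i\<in>keys v. scale (lookup v i) (g i)) = 0"
  shows "\<exists>f. Vector_Spaces.linear scale_ext scale f \<and> f 1 = 1 \<and> (\<forall>u v. f (u * v) = f u * f v) \<and>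
    (\<forall>j. f (bvec j) = g j)"
proof -
  from lift_exists[OF lin_ext_alt_ideal, OF assms]
  obtain f where f: "\<And>x. f (abs_exterior x) = lin_ext (word_prod g) x"
    and lin: "Vector_Spaces.linear scale_ext scale f" by blast
  have "f 1 = 1"
    using lin_ext_single[of "word_prod g" 0 1]
    by (simp add: one_exterior.abs_eq f single_one)
  moreover have "f (u * v) = f u * f v" for u v
    by (cases u rule: exterior_exhaust; cases v rule: exterior_exhaust) (simp add: times_exterior.abs_eq f lin_ext_mult word_prod_add)
  moreover have "f (bvec j) = g j" for j
    by (simp add: bvec_def vect.abs_eq f lin_ext_tensor_of_vec)
  ultimately show ?thesis using lin by blast
qed

end

interpretation ext: rat_algebra scale_ext
  by standard (simp_all add: scale_ext_mult_left scale_ext_mult_right)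

lemma abs_exterior_single: "abs_exterior (single (Word ws) c) = scale_ext c (prod_list (map bvec ws))"
proof -
  have "abs_exterior (single (Word ws) 1) = prod_list (map bvec ws)"
  proof (induction ws)
    case Nil
    show ?case by (simp add: one_exterior.abs_eq flip: zero_index_word_def single_one)
  next
    case (Cons i ws)
    have "single (Word (i # ws)) (1 :: rat) = single (Word [i]) 1 * single (Word ws) 1"
      by (simp add: mult_single plus_index_word_def)
    moreover have "bvec i = abs_exterior (single (Word [i]) 1)"
      by (simp add: bvec_def vect.abs_eq tensor_of_vec_def)
    ultimately show ?case using Cons by (simp flip: times_exterior.abs_eq)
  qed
  moreover have "single (Word ws) c = single 0 c * single (Word ws) 1"
    by (simp add: mult_single)
  ultimately show ?thesis by (metis scale_ext.abs_eq)
qed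

lemma abs_exterior_eq: "abs_exterior x = ext.lin_ext (ext.word_prod bvec) x"
proof (induction x rule: poly_mapping_sum_induct)
  case (mono w c)
  show ?case by (cases w) (simp add: abs_exterior_single ext.word_prod_def)
qed (simp_all add: ext.lin_ext_add flip: plus_exterior.abs_eq zero_exterior.abs_eq)

lemma exterior_induct [case_names wedge scale add]:
  assumes "\<And>ws. P (prod_list (map bvec ws))" "\<And>c u. P u \<Longrightarrow> P (scale_ext c u)"
    "\<And>u v. P u \<Longrightarrow> P v \<Longrightarrow> P (u + v)"
  shows "P u"
proof -
  have "P (abs_exterior x)" for x
  proof (induction x rule: poly_mapping_sum_induct)
    case zero
    show ?case using assms(2)[OF assms(1)[of "[]"], of 0]
      by (simp flip: zero_exterior.abs_eq)
  next
    case (mono w c)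
    show ?case using assms(1,2) by (cases w) (auto simp: abs_exterior_single)
  next
    case (add x y)
    then show ?case using assms(3) by (simp flip: plus_exterior.abs_eq)
  qed
  then show ?thesis by (cases u rule: exterior_exhaust) auto
qed

lemma vect_eq_sum: "vect v = (\<Sum>i\<in>keys v. scale_ext (lookup v i) (bvec i))"
  by (simp add: vect.abs_eq abs_exterior_eq ext.lin_ext_tensor_of_vec)

lemma vect_square: "vect v * vect v = 0"
  using alt_ideal.step[OF alt_ideal.zero, of 1 v 1]
  by transfer simp

lemma vect_add: "vect (v + v') = vect v + vect v'"
proof -
  let ?K = "keys v \<union> keys v'"
  have "keys (v + v') \<subseteq> ?K" by (rule keys_add)
  have *: "vect u = (\<Sum>i\<in>?K. scale_ext (lookup u i) (bvec i))" if "keys u \<subseteq> ?K" for u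
    unfolding vect_eq_sum using that by (intro sum.mono_neutral_left) (auto simp: in_keys_iff)
  show ?thesis
    using \<open>keys (v + v') \<subseteq> ?K\<close>
    by (simp add: * lookup_add ext.scale_left_distrib sum.distrib)
qed

lemma vect_anticommute: "vect v * vect v' = - (vect v' * vect v)"
proof -
  have "0 = vect (v + v') * vect (v + v')" by (simp only: vect_square)
  also have "\<dots> = vect v * vect v' + vect v' * vect v"
    by (simp add: vect_add algebra_simps vect_square)
  finally show ?thesis by (simp add: eq_neg_iff_add_eq_0)
qed

subsection \<open>Contraction\<close>

fun contract_word :: "covec_V \<Rightarrow> nat list \<Rightarrow> exterior" where
  "contract_word \<beta> [] = 0"
| "contract_word \<beta> (i # ws) =
     scale_ext (lookup \<beta> i) (prod_list (map bvec ws)) - bvec i * contract_word \<beta> ws"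

lemma contract_word_append:
  "contract_word \<beta> (vs @ ws) = contract_word \<beta> vs * prod_list (map bvec ws) +
     prod_list (map (\<lambda>i. - bvec i) vs) * contract_word \<beta> ws"
  by (induction vs) (simp_all add: algebra_simps scale_ext_mult_left)

abbreviation contract_tensor :: "covec_V \<Rightarrow> tensor \<Rightarrow> exterior" where
  "contract_tensor \<beta> \<equiv> ext.lin_ext (\<lambda>w. contract_word \<beta> (letters w))"

abbreviation sign_tensor :: "tensor \<Rightarrow> exterior" where
  "sign_tensor \<equiv> ext.lin_ext (ext.word_prod (\<lambda>i. - bvec i))"

lemma contract_tensor_mult:
  "contract_tensor \<beta> (x * y) = contract_tensor \<beta> x * abs_exterior y + sign_tensor x * contract_tensor \<beta> y"
proof (induction x rule: poly_mapping_sum_induct)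
  case (mono v c)
  show ?case
  proof (induction y rule: poly_mapping_sum_induct)
    case (mono w d)
    show ?case
      by (cases v; cases w)
        (simp add: mult_single plus_index_word_def contract_word_append ext.word_prod_def
          abs_exterior_single scale_ext_mult_left scale_ext_mult_right ext.scale_right_distrib
          mult.commute[of c d])
  qed (simp_all add: ext.lin_ext_add algebra_simps flip: plus_exterior.abs_eq zero_exterior.abs_eq)
qed (simp_all add: ext.lin_ext_add algebra_simps)

lemma sign_tensor_mult: "sign_tensor (x * y) = sign_tensor x * sign_tensor y"
  by (simp add: ext.lin_ext_mult ext.word_prod_add)

lemma sign_tensor_of_vec: "sign_tensor (tensor_of_vec v) = - vect v"
  by (simp add: ext.lin_ext_tensor_of_vec vect_eq_sum sum_negf)

lemma contract_tensor_of_vec: "contract_tensor \<beta> (tensor_of_vec v) = scale_ext (pairing \<beta> v) 1"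
  by (simp add: tensor_of_vec_def ext.lin_ext_sum pairing_def ext.scale_sum_left mult.commute)

lemma contract_tensor_alt_ideal: "x \<in> alt_ideal \<Longrightarrow> contract_tensor \<beta> x = 0"
proof (induction x rule: alt_ideal.induct)
  case (step x l v r)
  let ?v = "tensor_of_vec v"
  have v: "abs_exterior ?v = vect v" by (simp add: vect.abs_eq)
  have "contract_tensor \<beta> (?v * ?v) = 0"
    by (simp add: contract_tensor_mult contract_tensor_of_vec sign_tensor_of_vec v
        scale_ext_mult_left scale_ext_mult_right)
  moreover have "abs_exterior (?v * ?v) = 0"
    by (simp add: v vect_square flip: times_exterior.abs_eq)
  moreover have "sign_tensor (?v * ?v) = 0"
    by (simp add: sign_tensor_mult sign_tensor_of_vec vect_square)
  ultimately have "contract_tensor \<beta> (l * (?v * ?v) * r) = 0"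
    by (simp add: contract_tensor_mult sign_tensor_mult)
  with step show ?case by (simp add: ext.lin_ext_add)
qed simp

lemma contract_exists:
  "\<exists>d. Vector_Spaces.linear scale_ext scale_ext d \<and>
     (\<forall>v u. d (vect v * u) = scale_ext (pairing \<beta> v) u - vect v * d u) \<and> d 1 = 0"
proof -
  from ext.lift_exists[OF contract_tensor_alt_ideal[of _ \<beta>]]
  obtain d where d: "\<And>x. d (abs_exterior x) = contract_tensor \<beta> x"
    and lin: "Vector_Spaces.linear scale_ext scale_ext d" by blast
  have "d (vect v * u) = scale_ext (pairing \<beta> v) u - vect v * d u" for v u
  proof (cases u rule: exterior_exhaust)
    case (1 x)
    then show ?thesis
      by (simp add: vect.abs_eq times_exterior.abs_eq d contract_tensor_mult
          contract_tensor_of_vec sign_tensor_of_vec scale_ext_mult_left)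
  qed
  moreover have "d 1 = 0"
    using d[of 1] ext.lin_ext_single[of "\<lambda>w. contract_word \<beta> (letters w)" 0 1]
    by (simp add: one_exterior.abs_eq single_one) (simp add: zero_index_word_def)
  ultimately show ?thesis using lin by blast
qed

lemma pairing_single: "pairing \<beta> (single i 1) = lookup \<beta> i"
  by (simp add: pairing_def)

lemma contract_formula_from_recursion:
  assumes lin: "Vector_Spaces.linear scale_ext scale_ext d"
    and rec: "\<And>v u. d (vect v * u) = scale_ext (pairing \<beta> v) u - vect v * d u" and "d 1 = 0"
  shows "d (prod_list (map vect us)) =
    (\<Sum>j<length us. scale_ext ((- 1) ^ j * pairing \<beta> (us ! j))
       (prod_list (map vect (take j us @ drop (Suc j) us))))"
proof (induction us)
  case (Cons u us)
  show ?case
    by (simp add: rec Cons sum.lessThan_Suc_shift sum_distrib_left scale_ext_mult_right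
        ext.scale_minus_left sum_negf mult.assoc del: sum.lessThan_Suc)
qed (simp add: \<open>d 1 = 0\<close>)

lemma linear_ext_eqI:
  assumes "Vector_Spaces.linear scale_ext s f" "Vector_Spaces.linear scale_ext s g"
    and "\<And>ws. f (prod_list (map bvec ws)) = g (prod_list (map bvec ws))"
  shows "f = g"
proof
  fix u
  show "f u = g u"
    using assms by (induction u rule: exterior_induct) (simp_all add: Vector_Spaces.linear_iff)
qed

lemma contract_unique_existence:
  "\<exists>!d. Vector_Spaces.linear scale_ext scale_ext d \<and>
     (\<forall>us. d (prod_list (map vect us)) =
       (\<Sum>j<length us. scale_ext ((- 1) ^ j * pairing \<beta> (us ! j))
          (prod_list (map vect (take j us @ drop (Suc j) us)))))"
  (is "\<exists>!d. ?lin d \<and> ?formula d")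
proof (rule ex_ex1I)
  show "\<exists>d. ?lin d \<and> ?formula d"
    using contract_exists[of \<beta>] contract_formula_from_recursion by blast
next
  fix d d'
  assume d: "?lin d \<and> ?formula d" and d': "?lin d' \<and> ?formula d'"
  show "d = d'"
  proof (rule linear_ext_eqI)
    fix ws
    have "prod_list (map bvec ws) = prod_list (map vect (map (\<lambda>i. single i 1) ws))"
      by (simp add: bvec_def[abs_def] comp_def)
    with d d' show "d (prod_list (map bvec ws)) = d' (prod_list (map bvec ws))"
      by metis
  qed (use d d' in blast)+
qed

lemmas linear_contract = contract_unique_existence[THEN theI', folded contract_def, THEN conjunct1]

lemma contract_prod_list:
  "contract \<beta> (prod_list (map vect us)) =
     (\<Sum>j<length us. scale_ext ((- 1) ^ j * pairing \<beta> (us ! j))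
        (prod_list (map vect (take j us @ drop (Suc j) us))))"
  using contract_unique_existence[THEN theI', folded contract_def] by blast

lemma contract_eqI:
  assumes "Vector_Spaces.linear scale_ext scale_ext d"
    and "\<And>v u. d (vect v * u) = scale_ext (pairing \<beta> v) u - vect v * d u" and "d 1 = 0"
  shows "contract \<beta> = d"
  unfolding contract_def
  using contract_unique_existence[of \<beta>] contract_formula_from_recursion[OF assms] assms(1)
  by (intro the1_equality) blast+

lemma contract_vect_mult: "contract \<beta> (vect v * u) = scale_ext (pairing \<beta> v) u - vect v * contract \<beta> u"
  and contract_1: "contract \<beta> 1 = 0"
proof -
  from contract_exists[of \<beta>] obtain d where lin: "Vector_Spaces.linear scale_ext scale_ext d"
    and rec: "\<And>v u. d (vect v * u) = scale_ext (pairing \<beta> v) u - vect v * d u" and 1: "d 1 = 0"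
    by blast
  from contract_eqI[OF this] have "contract \<beta> = d" .
  with rec 1 show "contract \<beta> (vect v * u) = scale_ext (pairing \<beta> v) u - vect v * contract \<beta> u"
    "contract \<beta> 1 = 0" by auto
qed

lemma contract_bvec_mult:
  "contract \<beta> (bvec i * u) = scale_ext (lookup \<beta> i) u - bvec i * contract \<beta> u"
  unfolding bvec_def by (simp add: contract_vect_mult pairing_single)

lemma contract_add: "contract \<beta> (u + v) = contract \<beta> u + contract \<beta> v"
  and contract_scale: "contract \<beta> (scale_ext c u) = scale_ext c (contract \<beta> u)"
  using linear_contract[of \<beta>] by (simp_all add: Vector_Spaces.linear_iff)

lemma contract_0: "contract \<beta> 0 = 0"
  using contract_scale[of \<beta> 0 0] by simp

lemma contract_zero_covector: "contract 0 u = 0"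
proof -
  have "contract 0 = (\<lambda>u. 0)"
    by (rule contract_eqI)
      (auto simp: Vector_Spaces.linear_iff vector_space_scale_ext pairing_def)
  then show ?thesis by simp
qed

lemma finite_contract_beta: "finite {j. contract (single j 1) u \<noteq> 0}"
proof (induction u rule: exterior_induct)
  case (wedge ws)
  have "contract (single j 1) (prod_list (map bvec ws)) = 0" if "j \<notin> set ws" for j
    using that by (induction ws) (auto simp: contract_1 contract_bvec_mult lookup_single)
  then have "{j. contract (single j 1) (prod_list (map bvec ws)) \<noteq> 0} \<subseteq> set ws" by blast
  then show ?case by (rule finite_subset) simp
next
  case (scale c u)
  have "{j. contract (single j 1) (scale_ext c u) \<noteq> 0} \<subseteq> {j. contract (single j 1) u \<noteq> 0}"
    by (auto simp: contract_scale)
  then show ?case using scale by (rule finite_subset)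
next
  case (add u v)
  have "{j. contract (single j 1) (u + v) \<noteq> 0} \<subseteq>
      {j. contract (single j 1) u \<noteq> 0} \<union> {j. contract (single j 1) v \<noteq> 0}"
    by (auto simp: contract_add)
  then show ?case using add by (meson finite_UnI finite_subset)
qed

subsection \<open>The maps \<open>sigma_plus\<close> and \<open>sigma_bar\<close>\<close>

lemma fps_const_scale: "scale_ext_fps c (fps_const u) = fps_const (scale_ext c u)"
  by (simp add: scale_ext_fps_def scale_ext_mult_left)

lemma fps_nth_scale_ext_fps: "fps_nth (scale_ext_fps c f) n = scale_ext c (fps_nth f n)"
  by (simp add: scale_ext_fps_def scale_ext_mult_left)

interpretation ext_fps: rat_algebra scale_ext_fps
proof
  fix a b c :: rat and x y :: "exterior fps"
  show "scale_ext_fps a (x + y) = scale_ext_fps a x + scale_ext_fps a y"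
    by (simp add: fps_eq_iff fps_nth_scale_ext_fps ext.scale_right_distrib)
  show "scale_ext_fps (a + b) x = scale_ext_fps a x + scale_ext_fps b x"
    by (simp add: fps_eq_iff fps_nth_scale_ext_fps ext.scale_left_distrib)
  show "scale_ext_fps a (scale_ext_fps b x) = scale_ext_fps (a * b) x"
    by (simp add: fps_eq_iff fps_nth_scale_ext_fps)
  show "scale_ext_fps 1 x = x"
    by (simp add: fps_eq_iff fps_nth_scale_ext_fps)
  show "scale_ext_fps c x * y = scale_ext_fps c (x * y)"
    by (simp add: scale_ext_fps_def mult.assoc)
  show "x * scale_ext_fps c y = scale_ext_fps c (x * y)"
    by (simp add: fps_eq_iff fps_nth_scale_ext_fps fps_mult_nth scale_ext_mult_right ext.scale_sum_right)
qed

definition shift_vec :: "vec_V \<Rightarrow> exterior" where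
  "shift_vec v = (\<Sum>i\<in>keys v. scale_ext (lookup v i) (bvec (Suc i)))"

lemma shift_vec_is_vect: "\<exists>v'. shift_vec v = vect v'"
proof -
  have "\<exists>v'. (\<Sum>i\<in>S. scale_ext (lookup v i) (bvec (Suc i))) = vect v'" if "finite S" for S
    using that
  proof induction
    case empty
    have "vect 0 = 0" by (simp add: vect_eq_sum)
    then show ?case by (metis sum.empty)
  next
    case (insert i S)
    then obtain v' where "(\<Sum>i\<in>S. scale_ext (lookup v i) (bvec (Suc i))) = vect v'" by blast
    moreover have "scale_ext (lookup v i) (bvec (Suc i)) = vect (single (Suc i) (lookup v i))"
      by (cases "lookup v i = 0") (auto simp: vect_eq_sum)
    ultimately show ?case using insert by (auto simp flip: vect_add)
  qed
  then show ?thesis by (simp add: shift_vec_def)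
qed

lemma sigma_plus_square:
  fixes g defines "g \<equiv> \<lambda>j. fps_const (bvec j) - fps_const (bvec (Suc j)) * fps_X"
  shows "(\<Sum>i\<in>keys v. scale_ext_fps (lookup v i) (g i)) *
    (\<Sum>i\<in>keys v. scale_ext_fps (lookup v i) (g i)) = 0"
proof -
  have sum_const: "(\<Sum>i\<in>S. fps_const (f i)) = fps_const (sum f S)" for f :: "nat \<Rightarrow> exterior" and S
    by (induction S rule: infinite_finite_induct) (simp_all flip: fps_const_add)
  obtain v' where v': "shift_vec v = vect v'" using shift_vec_is_vect by blast
  have "(\<Sum>i\<in>keys v. scale_ext_fps (lookup v i) (g i)) = fps_const (vect v) - fps_const (vect v') * fps_X"
    by (simp add: g_def ext_fps.scale_right_diff_distrib sum_subtractf fps_const_scale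
        vect_eq_sum[of v] sum_const flip: v' ext_fps.scale_mult_left sum_distrib_right)
      (simp add: shift_vec_def)
  also have "\<dots> * \<dots> = fps_const (vect v * vect v) - fps_const (vect v * vect v' + vect v' * vect v) * fps_X
      + fps_const (vect v' * vect v') * fps_X * fps_X"
  proof -
    have c: "fps_const (vect v') * fps_X = fps_X * fps_const (vect v')"
      "fps_X * (fps_const (vect v') * fps_X) = fps_const (vect v') * fps_X * fps_X"
      "fps_X * (fps_const (vect v)) = fps_const (vect v) * fps_X"
      using fps_mult_fps_X_commute by metis+
    show ?thesis
      by (simp add: algebra_simps c(2,3) flip: fps_const_mult fps_const_add)
  qed
  also have "\<dots> = 0" by (simp add: vect_square vect_anticommute[of v v'])
  finally show ?thesis .
qed

lemma sigma_plus_unique_existence: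
  "\<exists>!s. Vector_Spaces.linear scale_ext scale_ext_fps s \<and> s 1 = 1 \<and>
     (\<forall>u v. s (u * v) = s u * s v) \<and>
     (\<forall>j. s (bvec j) = fps_const (bvec j) - fps_const (bvec (Suc j)) * fps_X)"
  (is "\<exists>!s. ?P s")
proof (rule ex_ex1I)
  show "\<exists>s. ?P s"
    using ext_fps.hom_exists[OF sigma_plus_square] by blast
next
  fix s s' assume s: "?P s" and s': "?P s'"
  show "s = s'"
  proof (rule linear_ext_eqI)
    fix ws show "s (prod_list (map bvec ws)) = s' (prod_list (map bvec ws))"
      using s s' by (induction ws) simp_all
  qed (use s s' in blast)+
qed

lemma sigma_plus_props:
  shows linear_sigma_plus: "Vector_Spaces.linear scale_ext scale_ext_fps sigma_plus"
    and sigma_plus_1: "sigma_plus 1 = 1"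
    and sigma_plus_mult: "sigma_plus (u * v) = sigma_plus u * sigma_plus v"
    and sigma_plus_bvec: "sigma_plus (bvec j) = fps_const (bvec j) - fps_const (bvec (Suc j)) * fps_X"
  using sigma_plus_unique_existence[THEN theI', folded sigma_plus_def] by blast+

lemma sigma_bar_add: "sigma_bar n (u + v) = sigma_bar n u + sigma_bar n v"
  and sigma_bar_scale: "sigma_bar n (scale_ext c u) = scale_ext c (sigma_bar n u)"
  using linear_sigma_plus
  by (simp_all add: sigma_bar_def Vector_Spaces.linear_iff fps_nth_scale_ext_fps algebra_simps scale_ext_mult_right)

lemma sigma_bar_1: "sigma_bar n 1 = (if n = 0 then 1 else 0)"
  by (simp add: sigma_bar_def sigma_plus_1)

lemma sigma_bar_bvec_mult:
  "sigma_bar n (bvec j * u) = bvec j * sigma_bar n u +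
     (if n = 0 then 0 else bvec (Suc j) * sigma_bar (n - 1) u)"
proof -
  have comm: "(- 1) ^ m * (x * y) = x * ((- 1) ^ m * y)" for m and x y :: exterior
    by (cases "even m") simp_all
  have "fps_nth (sigma_plus (bvec j * u)) n = bvec j * fps_nth (sigma_plus u) n -
      (if n = 0 then 0 else bvec (Suc j) * fps_nth (sigma_plus u) (n - 1))"
    by (simp add: sigma_plus_mult sigma_plus_bvec left_diff_distrib mult.assoc)
  then show ?thesis
    by (cases n) (simp_all add: sigma_bar_def comm right_diff_distrib)
qed

lemma sigma_bar_commute: "sigma_bar m (sigma_bar n u) = sigma_bar n (sigma_bar m u)"
proof (induction u rule: exterior_induct)
  case (wedge ws)
  show ?case
  proof (induction ws arbitrary: m n)
    case Nil
    have "sigma_bar k 0 = 0" for k using sigma_bar_scale[of k 0 0] by simp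
    then show ?case by (simp add: sigma_bar_1)
  next
    case (Cons j ws)
    have "sigma_bar k 0 = 0" for k using sigma_bar_scale[of k 0 0] by simp
    with Cons show ?case by (simp add: sigma_bar_bvec_mult sigma_bar_add algebra_simps)
  qed
qed (simp_all add: sigma_bar_add sigma_bar_scale)

subsection \<open>Finiteness of the sums over all exponents\<close>

lemma beta_series_single: "beta_series i (single i (- int j)) = single j 1"
  by (auto simp: beta_series_def)

lemma finite_contract_beta_series:
  "finite {p. (\<Sum>q\<in>keys U. single (p + q) (contract (beta_series i p) (lookup U q))) \<noteq> 0}"
proof (rule finite_subset)
  let ?J = "\<Union>q\<in>keys U. {j. contract (single j 1) (lookup U q) \<noteq> 0}"
  show "finite ((\<lambda>j. single i (- int j)) ` ?J)" by (simp add: finite_contract_beta)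
  show "{p. (\<Sum>q\<in>keys U. single (p + q) (contract (beta_series i p) (lookup U q))) \<noteq> 0}
      \<subseteq> (\<lambda>j. single i (- int j)) ` ?J"
  proof
    fix p assume "p \<in> {p. (\<Sum>q\<in>keys U. single (p + q) (contract (beta_series i p) (lookup U q))) \<noteq> 0}"
    then obtain q where "q \<in> keys U" "single (p + q) (contract (beta_series i p) (lookup U q)) \<noteq> 0"
      by (auto elim!: sum.not_neutral_contains_not_neutral)
    then have q: "q \<in> keys U" "contract (beta_series i p) (lookup U q) \<noteq> 0" by auto
    then have "beta_series i p \<noteq> 0" by (auto simp: contract_zero_covector)
    then obtain j where "p = single i (- int j)" by (auto simp: beta_series_def split: if_splits)
    with q show "p \<in> (\<lambda>j. single i (- int j)) ` ?J" by (auto simp: beta_series_single)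
  qed
qed

lemma sigma_minus_eq:
  assumes "\<And>j. j < 0 \<Longrightarrow> a j = 0"
  shows "sigma_minus i a j = (if j < 0 then 0 else \<Sum>n\<le>nat j. a (j - int n) * wpow i (- int n))"
proof (cases "j < 0")
  case True
  then show ?thesis by (simp add: sigma_minus_def assms)
next
  case False
  have "{n. a (j - int n) * wpow i (- int n) \<noteq> 0} \<subseteq> {..nat j}"
    using False assms by (auto simp: not_less intro: ccontr)
  then show ?thesis using False
    by (simp add: sigma_minus_def Sum_any.expand_superset[of "{..nat j}"])
qed

lemma Epoly_mult_hseq:
  "fps_of_poly (Epoly m) * Abs_fps (\<lambda>n. hseq m (int n)) = 1"
proof -
  have "coeff (Epoly m) 0 = 1"
    by (simp add: Epoly_def coeff_sum esym_def if_distrib[of "\<lambda>x. _ * x"] cong: if_cong)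
  moreover have "Abs_fps (\<lambda>n. hseq m (int n)) = fps_right_inverse (fps_of_poly (Epoly m)) 1"
    by (simp add: hseq_def fps_eq_iff)
  ultimately show ?thesis
    by (simp only:) (rule fps_right_inverse, simp)
qed

subsection \<open>Linear independence of the vectors \<open>bwedge r lam\<close> and existence of \<open>\<Gamma>\<^sup>*\<close>\<close>

lemma counit_exists:
  "\<exists>f. Vector_Spaces.linear scale_ext (*) f \<and> f 1 = 1 \<and> (\<forall>u v. f (u * v) = f u * f v) \<and>
     (\<forall>j. f (bvec j) = 0)"
proof -
  interpret rat_algebra "(*) :: rat \<Rightarrow> rat \<Rightarrow> rat"
    by standard (simp_all add: algebra_simps)
  show ?thesis by (rule hom_exists) simp
qed

definition contract_indices :: "nat list \<Rightarrow> exterior \<Rightarrow> exterior" where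
  "contract_indices js u = fold (\<lambda>j. contract (single j 1)) js u"

lemma contract_indices_simps [simp]:
  "contract_indices [] u = u"
  "contract_indices (j # js) u = contract_indices js (contract (single j 1) u)"
  by (simp_all add: contract_indices_def)

lemma contract_indices_add: "contract_indices js (u + v) = contract_indices js u + contract_indices js v"
  and contract_indices_scale: "contract_indices js (scale_ext c u) = scale_ext c (contract_indices js u)"
  by (induction js arbitrary: u v) (simp_all add: contract_add contract_scale)

lemma contract_beta_not_in:
  "j \<notin> set ws \<Longrightarrow> contract (single j 1) (prod_list (map bvec ws)) = 0"
  by (induction ws) (auto simp: contract_1 contract_bvec_mult lookup_single)

lemma contract_indices_not_in:
  "i \<notin> set js \<Longrightarrow> \<exists>c. contract_indices js (bvec i * u) = scale_ext c (bvec i * contract_indices js u)"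
proof (induction js arbitrary: u)
  case Nil
  show ?case by (rule exI[of _ 1]) simp
next
  case (Cons j js)
  let ?u = "contract (single j 1) u"
  obtain c where "contract_indices js (bvec i * ?u) = scale_ext c (bvec i * contract_indices js ?u)"
    using Cons by auto
  moreover have "contract (single j 1) (bvec i * u) = scale_ext (- 1) (bvec i * ?u)"
    using Cons.prems by (simp add: contract_bvec_mult lookup_single)
  ultimately show ?case by (simp add: contract_indices_scale del: ext.scale_minus_left)
qed

lemma contract_indices_dual_basis:
  assumes f: "Vector_Spaces.linear scale_ext (*) f" "f 1 = 1" "\<And>u v. f (u * v) = f u * f v"
      "\<And>j. f (bvec j) = 0"
    and "length js = length ws" "sorted_wrt (>) js" "sorted_wrt (>) ws"
  shows "f (contract_indices js (prod_list (map bvec ws))) = (if js = ws then 1 else 0)"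
  using assms(5-)
proof (induction js ws rule: list_induct2)
  case Nil
  show ?case by (simp add: f)
next
  case (Cons j js i ws)
  have f_scale: "f (scale_ext c u) = c * f u" for c u
    using f(1) by (simp add: Vector_Spaces.linear_iff)
  have zero: "contract_indices js 0 = 0" "f 0 = 0"
    using contract_indices_scale[of js 0 0] f_scale[of 0 0] by simp_all
  consider "j > i" | "j = i" | "j < i" by linarith
  then show ?case
  proof cases
    case 1
    with Cons.prems have "j \<notin> set (i # ws)" by auto
    from contract_beta_not_in[OF this] 1 show ?thesis by (simp add: zero)
  next
    case 2
    with Cons.prems have "j \<notin> set ws" by auto
    with 2 show ?thesis
      using Cons by (simp add: contract_bvec_mult contract_beta_not_in)
  next
    case 3
    let ?u = "contract (single j 1) (prod_list (map bvec ws))"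
    have "contract (single j 1) (bvec i * prod_list (map bvec ws)) = scale_ext (- 1) (bvec i * ?u)"
      using 3 by (simp add: contract_bvec_mult lookup_single)
    moreover have "i \<notin> set js" using 3 Cons.prems by auto
    from contract_indices_not_in[OF this]
    obtain c where "contract_indices js (bvec i * ?u) = scale_ext c (bvec i * contract_indices js ?u)"
      by blast
    ultimately show ?thesis
      using 3 by (simp add: contract_indices_scale f_scale f del: ext.scale_minus_left)
  qed
qed

definition wedge_indices :: "nat \<Rightarrow> nat list \<Rightarrow> nat list" where
  "wedge_indices r lam = map (\<lambda>j. r - 1 - j + lam ! j) [0..<r]"

lemma bwedge_eq: "bwedge r lam = prod_list (map bvec (wedge_indices r lam))"
  by (simp add: bwedge_def wedge_indices_def comp_def)

lemma wedge_indices_sorted: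
  assumes "lam \<in> partitions_le r"
  shows "sorted_wrt (>) (wedge_indices r lam)"
proof -
  have "r - 1 - i + lam ! i > r - 1 - j + lam ! j" if "i < j" "j < r" for i j
  proof -
    have "lam ! i \<ge> lam ! j"
      using assms that by (auto simp: partitions_le_def sorted_wrt_iff_nth_less)
    with that show ?thesis by linarith
  qed
  then show ?thesis by (simp add: wedge_indices_def sorted_wrt_iff_nth_less)
qed

lemma wedge_indices_inj:
  assumes "lam \<in> partitions_le r" "mu \<in> partitions_le r" "wedge_indices r lam = wedge_indices r mu"
  shows "lam = mu"
proof (rule nth_equalityI)
  fix j assume "j < length lam"
  with assms(1) have j: "j < r" by (simp add: partitions_le_def)
  have "wedge_indices r lam ! j = wedge_indices r mu ! j" by (simp add: assms)
  with j show "lam ! j = mu ! j" by (simp add: wedge_indices_def)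
qed (use assms in \<open>simp add: partitions_le_def\<close>)

lemma bwedge_dual:
  assumes "lam \<in> partitions_le r"
  shows "\<exists>\<phi>. Vector_Spaces.linear scale_ext (*) \<phi> \<and>
    (\<forall>mu\<in>partitions_le r. \<phi> (bwedge r mu) = (if mu = lam then 1 else 0))"
proof -
  obtain f where f: "Vector_Spaces.linear scale_ext (*) f" "f 1 = 1" "\<And>u v. f (u * v) = f u * f v"
      "\<And>j. f (bvec j) = 0" using counit_exists by blast
  let ?phi = "\<lambda>u. f (contract_indices (wedge_indices r lam) u)"
  have "Vector_Spaces.linear scale_ext (*) ?phi"
    using f(1) by (simp add: Vector_Spaces.linear_iff contract_indices_add contract_indices_scale)
  moreover have "?phi (bwedge r mu) = (if mu = lam then 1 else 0)" if "mu \<in> partitions_le r" for mu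
  proof -
    have "?phi (bwedge r mu) = (if wedge_indices r lam = wedge_indices r mu then 1 else 0)"
      unfolding bwedge_eq
      by (rule contract_indices_dual_basis[OF f])
        (use assms that in \<open>simp_all add: wedge_indices_sorted, simp add: wedge_indices_def\<close>)
    then show ?thesis using wedge_indices_inj[OF assms that] by auto
  qed
  ultimately show ?thesis by blast
qed

lemma inj_on_bwedge: "inj_on (bwedge r) (partitions_le r)"
  by (rule inj_onI) (metis bwedge_dual zero_neq_one)

lemma independent_bwedge: "ext.independent (bwedge r ` partitions_le r)"
  unfolding ext.independent_explicit_module
proof (intro allI impI)
  fix S c v
  assume S: "finite S" "S \<subseteq> bwedge r ` partitions_le r" "(\<Sum>v\<in>S. scale_ext (c v) v) = 0" "v \<in> S"
  then obtain lam where lam: "lam \<in> partitions_le r" "v = bwedge r lam" by blast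
  from bwedge_dual[OF lam(1)] obtain \<phi> where lin: "Vector_Spaces.linear scale_ext (*) \<phi>"
    and \<phi>: "\<And>mu. mu \<in> partitions_le r \<Longrightarrow> \<phi> (bwedge r mu) = (if mu = lam then 1 else 0)" by blast
  interpret \<phi>: Vector_Spaces.linear scale_ext "(*)" \<phi> by (rule lin)
  have "\<phi> u = (if u = v then 1 else 0)" if u: "u \<in> S" for u
  proof -
    obtain mu where "mu \<in> partitions_le r" "u = bwedge r mu" using u S(2) by blast
    with \<phi> lam show ?thesis using inj_on_bwedge by (auto dest: inj_onD)
  qed
  then have "(\<Sum>u\<in>S. c u * \<phi> u) = (\<Sum>u\<in>S. if u = v then c u else 0)"
    by (intro sum.cong) auto
  also have "\<dots> = c v" using S(1,4) by simp
  finally have "(\<Sum>u\<in>S. c u * \<phi> u) = c v" .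
  moreover have "(\<Sum>u\<in>S. c u * \<phi> u) = \<phi> (\<Sum>u\<in>S. scale_ext (c u) u)"
    by (simp add: \<phi>.sum \<phi>.scale)
  ultimately show "c v = 0" using S(3) by (simp add: \<phi>.zero)
qed

lemma lookup_scale_laurent_const:
  "lookup (scale_laurent (lconst c) U) p = scale_ext c (lookup U p)"
proof -
  have "scale_laurent (lconst c) U = (\<Sum>q\<in>keys U. single q (scale_ext c (lookup U q)))"
    by (cases "c = 0") (simp_all add: laurent_bilin_def lconst_def)
  then show ?thesis
    by (auto simp: lookup_sum lookup_single when_def in_keys_iff sum.delta)
qed

lemma vector_space_scale_laurent: "vector_space (\<lambda>c. scale_laurent (lconst c))"
  by standard (auto intro!: poly_mapping_eqI
      simp: lookup_scale_laurent_const lookup_add ext.scale_right_distrib ext.scale_left_distrib)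

lemma Gamma_star_exists:
  "\<exists>G. Vector_Spaces.linear scale_ext (\<lambda>c. scale_laurent (lconst c)) G \<and>
     (\<forall>lam\<in>partitions_le r. G (bwedge r lam) =
        B_act_laurent (Gamma_star_coeff k r lam)
          (lconst (bwedge (r - k) (empty_partition (r - k)))))"
proof -
  interpret vector_space_pair scale_ext "\<lambda>c. scale_laurent (lconst c)"
    by (intro vector_space_pair.intro vector_space_scale_ext vector_space_scale_laurent)
  let ?inv = "inv_into (partitions_le r) (bwedge r)"
  from linear_independent_extend[OF independent_bwedge[of r],
      where f = "\<lambda>u. B_act_laurent (Gamma_star_coeff k r (?inv u))
        (lconst (bwedge (r - k) (empty_partition (r - k))))"]
  show ?thesis by (auto simp: inv_into_f_f[OF inj_on_bwedge])
qed

lemma linear_Gamma_star: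
  "Vector_Spaces.linear scale_ext (\<lambda>c. scale_laurent (lconst c)) (Gamma_star k r)"
  using someI_ex[OF Gamma_star_exists[of r k]] by (simp add: Gamma_star_def)

lemma Gamma_star_bwedge:
  assumes "lam \<in> partitions_le r"
  shows "Gamma_star k r (bwedge r lam) =
    B_act_laurent (Gamma_star_coeff k r lam) (lconst (bwedge (r - k) (empty_partition (r - k))))"
  using someI_ex[OF Gamma_star_exists[of r k]] assms by (simp add: Gamma_star_def)

end

theory Submission
  imports Defs
begin

text \<open>Identify \<open>b\<^sub>i\<close> with \<open>x\<^sup>i\<close>, so that \<open>\<Lambda>\<^sup>m V\<close> becomes the space of alternating polynomials: the
  vector \<open>b\<^sub>n\<^sub>1 \<and> \<dots> \<and> b\<^sub>n\<^sub>m\<close> is the alternant \<open>det (x\<^sub>i ^ n\<^sub>j)\<close>. Contraction by \<open>\<beta>(w\<^sup>-\<^sup>1)\<close> substitutes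
  \<open>w\<^sup>-\<^sup>1\<close> for the first variable, and \<open>e\<^sub>i\<close> acts as multiplication by the elementary symmetric polynomial
  in the remaining ones. The left-hand side is therefore the alternant of exponents \<open>r - j + \<lambda>\<^sub>j\<close> in the
  variables \<open>w\<^sub>1\<^sup>-\<^sup>1, \<dots>, w\<^sub>k\<^sup>-\<^sup>1, x\<^sub>1, \<dots>, x\<^sub>m\<close> with \<open>m = r - k\<close>, and the bialternant formula writes it as
  the Vandermonde determinant of these variables times \<open>\<Delta>\<^sub>\<lambda>\<close> of their complete symmetric polynomials, which
  form the sequence \<open>\<sigma>\<^sub>-(w) H\<^sub>m\<close>. The factors \<open>w\<^sub>i\<^sup>-\<^sup>1 - x\<^sub>j\<close> of the Vandermonde determinant produce
  \<open>w\<^sub>i\<^sup>-\<^sup>m E\<^sub>m(w\<^sub>i)\<close>. In place of variables, the \<open>x\<^sub>j\<close> range over \<open>\<rat>\<close>, which still separates the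
  elements of \<open>\<Lambda>\<^sup>m V\<close>.\<close>

section \<open>Alternants and the bialternant formula\<close>

text \<open>Laplace expansion along the first row, in the shape of the contraction formula for a
  wedge of basis vectors. Lists of different lengths give 0, as a wedge of the wrong degree
  should.\<close>

fun alternant :: "'a::comm_ring_1 list \<Rightarrow> nat list \<Rightarrow> 'a" where
  "alternant [] ns = (if ns = [] then 1 else 0)"
| "alternant (y # ys) ns =
     (\<Sum>j<length ns. (- 1) ^ j * y ^ (ns ! j) * alternant ys (take j ns @ drop (Suc j) ns))"

lemma alternant_det:
  assumes "length ns = length ys"
  shows "alternant ys ns = det (mat (length ys) (length ys) (\<lambda>(i, j). ys ! i ^ (ns ! j)))"
  using assms
proof (induction ys arbitrary: ns)
  case (Cons y ys)
  define n where "n = length ys"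
  define A where "A = mat (Suc n) (Suc n) (\<lambda>(i, j). (y # ys) ! i ^ (ns ! j))"
  have len: "length ns = Suc n" using Cons.prems by (simp add: n_def)
  have minor: "mat_delete A 0 j = mat n n (\<lambda>(i, l). ys ! i ^ ((take j ns @ drop (Suc j) ns) ! l))"
    if "j < Suc n" for j
    using that len by (intro eq_matI) (auto simp: mat_delete_def A_def nth_append)
  have "det A = (\<Sum>j<Suc n. A $$ (0, j) * cofactor A 0 j)"
    by (rule laplace_expansion_row) (simp_all add: A_def)
  also have "\<dots> = alternant (y # ys) ns"
    unfolding alternant.simps len
  proof (rule sum.cong)
    fix j assume "j \<in> {..<Suc n}"
    then have j: "j < Suc n" by simp
    have "alternant ys (take j ns @ drop (Suc j) ns) = det (mat_delete A 0 j)"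
      unfolding minor[OF j] n_def using j len by (subst Cons.IH) (auto simp: n_def)
    with j show "A $$ (0, j) * cofactor A 0 j =
        (- 1) ^ j * y ^ (ns ! j) * alternant ys (take j ns @ drop (Suc j) ns)"
      by (simp add: A_def cofactor_def mult_ac)
  qed simp
  finally show ?case by (simp add: A_def n_def)
qed simp

text \<open>Each factor is an earlier entry minus a later one, the orientation that belongs to
  decreasing exponents \<open>r - 1 - j\<close>.\<close>

fun vandermonde_list :: "'a::comm_ring_1 list \<Rightarrow> 'a" where
  "vandermonde_list [] = 1"
| "vandermonde_list (y # ys) = (\<Prod>z\<leftarrow>ys. y - z) * vandermonde_list ys"

lemma vandermonde_list_append:
  "vandermonde_list (xs @ ys) = vandermonde_list xs * (\<Prod>x\<leftarrow>xs. \<Prod>y\<leftarrow>ys. x - y) * vandermonde_list ys"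
  by (induction xs) (simp_all add: mult_ac)

lemma vandermonde_list_nth:
  "vandermonde_list ys = (\<Prod>j = 0..<length ys. \<Prod>z\<leftarrow>drop (Suc j) ys. ys ! j - z)"
  by (induction ys) (simp_all add: prod.atLeast0_lessThan_Suc_shift del: prod.op_ivl_Suc)

lemma monic_prod_list_linear:
  "degree (\<Prod>z\<leftarrow>zs. [:- z, 1:] :: 'a::comm_ring_1 poly) \<le> length zs \<and>
   coeff (\<Prod>z\<leftarrow>zs. [:- z, 1:] :: 'a poly) (length zs) = 1"
proof (induction zs)
  case (Cons z zs)
  let ?p = "\<Prod>z\<leftarrow>zs. [:- z, 1:]"
  have "degree ([:- z, 1:] * ?p) \<le> Suc (length zs)"
    using degree_mult_le[of "[:- z, 1:]" ?p] Cons degree_pCons_le[of "- z" "[:1:]"] by simp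
  \<comment> \<open>The leading coefficient of the product is that of \<open>?p\<close> plus
    \<open>- z\<close> times this higher coefficient.\<close>
  moreover have "coeff ?p (Suc (length zs)) = 0"
    using Cons by (intro coeff_eq_0) simp
  ultimately show ?case using Cons by simp
qed simp

lemma poly_prod_list: "poly (prod_list ps) x = (\<Prod>p\<leftarrow>ps. poly p x)"
  by (induction ps) simp_all

lemma poly_prod_list_root:
  fixes z :: "'a::comm_ring_1"
  assumes "z \<in> set zs"
  shows "poly (\<Prod>z\<leftarrow>zs. [:- z, 1:]) z = 0"
  using assms by (induction zs) auto

text \<open>Column operations replace the powers \<open>y\<^sup>r\<^sup>-\<^sup>1\<^sup>-\<^sup>j\<close> by the monic polynomials whose roots are
  the \<open>y\<^sub>l\<close> with \<open>l > j\<close>, which makes the matrix triangular.\<close>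

lemma det_vandermonde:
  fixes ys :: "'a::comm_ring_1 list"
  defines "r \<equiv> length ys"
  shows "det (mat r r (\<lambda>(i, j). ys ! i ^ (r - 1 - j))) = vandermonde_list ys"
proof -
  define p where "p j = (\<Prod>z\<leftarrow>drop (Suc j) ys. [:- z, 1:])" for j
  have deg: "degree (p j) \<le> r - 1 - j" and lead: "coeff (p j) (r - 1 - j) = 1" for j
    using monic_prod_list_linear[of "drop (Suc j) ys"] by (simp_all add: p_def r_def)
  define X where "X = mat r r (\<lambda>(i, j). ys ! i ^ (r - 1 - j))"
  define P where "P = mat r r (\<lambda>(l, j). coeff (p j) (r - 1 - l))"
  define T where "T = mat r r (\<lambda>(i, j). poly (p j) (ys ! i))"
  have carrier: "X \<in> carrier_mat r r" "P \<in> carrier_mat r r" "T \<in> carrier_mat r r"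
    by (simp_all add: X_def P_def T_def)
  have "T = X * P"
  proof (rule eq_matI)
    fix i j assume "i < dim_row (X * P)" "j < dim_col (X * P)"
    then have ij: "i < r" "j < r" by (simp_all add: X_def P_def)
    have "poly (p j) (ys ! i) = (\<Sum>n\<le>r - 1. coeff (p j) n * ys ! i ^ n)"
      unfolding poly_altdef using deg[of j]
      by (intro sum.mono_neutral_left) (auto intro: le_degree)
    also have "\<dots> = (\<Sum>n<r. coeff (p j) n * ys ! i ^ n)"
      using ij by (intro sum.cong) auto
    also have "\<dots> = (\<Sum>l<r. ys ! i ^ (r - 1 - l) * coeff (p j) (r - 1 - l))"
      by (subst sum.nat_diff_reindex[symmetric]) (simp add: mult.commute)
    finally show "T $$ (i, j) = (X * P) $$ (i, j)"
      using ij by (simp add: T_def X_def P_def scalar_prod_def atLeast0LessThan)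
  qed (simp_all add: X_def P_def T_def)
  then have "det T = det X * det P" using carrier by (simp add: det_mult)
  moreover have "det P = 1"
  proof -
    have "det P = prod_list (diag_mat P)"
    proof (rule det_lower_triangular)
      fix i j assume "i < j" "j < r"
      then show "P $$ (i, j) = 0"
        using deg[of j] by (auto simp: P_def intro!: coeff_eq_0)
    qed (rule carrier)
    also have "diag_mat P = replicate r 1"
      by (rule nth_equalityI) (use lead in \<open>simp_all add: diag_mat_def P_def\<close>)
    finally show ?thesis by (simp add: prod_list_replicate)
  qed
  moreover have "det T = vandermonde_list ys"
  proof -
    have "upper_triangular T"
    proof
      fix i j assume "j < i" "i < dim_row T"
      then have "j < i" "i < r" by (simp_all add: T_def)
      then have "drop (Suc j) ys ! (i - Suc j) = ys ! i" "i - Suc j < length (drop (Suc j) ys)"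
        by (simp_all add: r_def)
      then have "ys ! i \<in> set (drop (Suc j) ys)" by (metis nth_mem)
      then have "poly (p j) (ys ! i) = 0"
        unfolding p_def by (simp add: poly_prod_list_root)
      with \<open>j < i\<close> \<open>i < r\<close> show "T $$ (i, j) = 0" by (simp add: T_def)
    qed
    then have "det T = prod_list (diag_mat T)" using carrier by (simp add: det_upper_triangular)
    also have "\<dots> = (\<Prod>j = 0..<r. poly (p j) (ys ! j))"
      by (simp add: diag_mat_def T_def prod.list_conv_set_nth)
    also have "\<dots> = vandermonde_list ys"
      by (simp add: vandermonde_list_nth r_def p_def poly_prod_list comp_def)
    finally show ?thesis .
  qed
  ultimately show ?thesis by (simp add: X_def)
qed

lemma geometric_fps: "Abs_fps (\<lambda>n. y ^ n) * (1 - fps_const y * fps_X) = (1 :: 'a::comm_ring_1 fps)"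
proof (rule fps_ext)
  fix n
  show "fps_nth (Abs_fps (\<lambda>n. y ^ n) * (1 - fps_const y * fps_X)) n = fps_nth 1 n"
    by (cases n) (simp_all add: right_diff_distrib mult.commute[of "fps_const y"] flip: mult.assoc)
qed

text \<open>The entries are \<open>a (i - j)\<close>, so the matrix is lower triangular with
  \<open>a 0\<close> on the diagonal. This normalization identifies the constant in the bialternant
  formula.\<close>

lemma Delta_empty:
  assumes "\<And>j. j < 0 \<Longrightarrow> a j = 0" "a 0 = 1"
  shows "Delta r (empty_partition r) a = 1"
proof -
  let ?D = "mat r r (\<lambda>(i, j). a (int (empty_partition r ! j) - int j + int i))"
  have "det ?D = prod_list (diag_mat ?D)"
    by (rule det_lower_triangular[where n = r]) (simp_all add: assms(1))
  also have "diag_mat ?D = replicate r 1"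
    by (rule nth_equalityI) (simp_all add: diag_mat_def assms(2))
  finally show ?thesis by (simp add: Delta_def prod_list_replicate)
qed

text \<open>If \<open>Q\<^sub>i\<close> is the product of the factors \<open>1 - y z\<close> over all \<open>y\<close> except \<open>y\<^sub>i\<close>, then the
  geometric series of \<open>y\<^sub>i\<close> is \<open>Q\<^sub>i\<close> times the generating function of \<open>a\<close>. Comparing coefficients
  factors the alternant matrix through the matrix of \<open>Delta\<close>.\<close>

lemma alternant_factorization:
  fixes ys :: "'a::comm_ring_1 list" and a :: "int \<Rightarrow> 'a"
  defines "r \<equiv> length ys"
  assumes neg: "\<And>j. j < 0 \<Longrightarrow> a j = 0"
    and gen: "Abs_fps (\<lambda>n. a (int n)) * (\<Prod>y\<leftarrow>ys. 1 - fps_const y * fps_X) = 1"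
  shows "\<exists>c. \<forall>lam. det (mat r r (\<lambda>(i, j). ys ! i ^ (r - 1 - j + lam ! j))) = c * Delta r lam a"
proof -
  define G where "G = Abs_fps (\<lambda>n. a (int n))"
  define Q where "Q i = (\<Prod>y\<leftarrow>take i ys @ drop (Suc i) ys. [:1, - y:])" for i
  define c where "c i n = coeff (Q i) n" for i n
  have of_Q: "fps_of_poly (Q i) = (\<Prod>y\<leftarrow>take i ys @ drop (Suc i) ys. 1 - fps_const y * fps_X)" for i
  proof -
    have "fps_of_poly (\<Prod>y\<leftarrow>zs. [:1, - y:]) = (\<Prod>y\<leftarrow>zs. 1 - fps_const y * fps_X)" for zs :: "'a list"
    proof (induction zs)
      case (Cons z zs)
      have "fps_of_poly [:1, - z:] = 1 - fps_const z * fps_X"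
        by (simp add: fps_of_poly_pCons mult.commute flip: fps_const_neg)
      with Cons show ?case by (simp only: list.map prod_list.Cons fps_of_poly_mult)
    qed simp
    then show ?thesis by (simp only: Q_def)
  qed
  have deg: "degree (\<Prod>y\<leftarrow>zs. [:1, - y:] :: 'a poly) \<le> length zs" for zs :: "'a list"
  proof (induction zs)
    case (Cons z zs)
    then show ?case
      using degree_mult_le[of "[:1, - z:]" "\<Prod>y\<leftarrow>zs. [:1, - y:]"] degree_pCons_le[of 1 "[:- z:]"]
      by simp
  qed simp
  have power: "ys ! i ^ n = (\<Sum>l<r. c i l * a (int n - int l))" if i: "i < r" for i n
  proof -
    let ?f = "1 - fps_const (ys ! i) * fps_X"
    have "(\<Prod>y\<leftarrow>ys. 1 - fps_const y * fps_X) = fps_of_poly (Q i) * ?f"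
      using i by (subst id_take_nth_drop[of i ys]) (simp_all add: of_Q r_def mult_ac)
    with gen have G: "(G * fps_of_poly (Q i)) * ?f = 1" by (simp add: G_def mult_ac)
    \<comment> \<open>The missing factor \<open>?f\<close> cancels against the geometric series of
      \<open>ys ! i\<close>, which leaves \<open>Q i\<close> times \<open>G\<close>.\<close>
    have "Abs_fps (\<lambda>n. ys ! i ^ n) = Abs_fps (\<lambda>n. ys ! i ^ n) * ((G * fps_of_poly (Q i)) * ?f)"
      by (simp add: G)
    also have "\<dots> = fps_of_poly (Q i) * G * (Abs_fps (\<lambda>n. ys ! i ^ n) * ?f)"
      by (simp only: mult_ac)
    finally have eq: "Abs_fps (\<lambda>n. ys ! i ^ n) = fps_of_poly (Q i) * G"
      by (simp add: geometric_fps)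
    have "ys ! i ^ n = (\<Sum>l = 0..n. c i l * a (int n - int l))"
      using arg_cong[OF eq, of "\<lambda>F. fps_nth F n"] by (simp add: fps_mult_nth G_def c_def of_nat_diff)
    \<comment> \<open>\<open>n\<close> may lie on either side of \<open>r\<close>: the terms with
      \<open>l > n\<close> vanish because \<open>a\<close> has a negative index there, those with
      \<open>l \<ge> r\<close> because \<open>degree (Q i) < r\<close>.\<close>
    also have "\<dots> = (\<Sum>l\<in>{0..n} \<union> {..<r}. c i l * a (int n - int l))"
      by (rule sum.mono_neutral_left) (auto simp: neg)
    also have "\<dots> = (\<Sum>l<r. c i l * a (int n - int l))"
    proof (rule sum.mono_neutral_right)
      have "degree (Q i) \<le> r - 1"
        unfolding Q_def by (rule order.trans[OF deg]) (use i in \<open>simp add: r_def\<close>)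
      then have "degree (Q i) < r" using i by linarith
      then show "\<forall>l\<in>{0..n} \<union> {..<r} - {..<r}. c i l * a (int n - int l) = 0"
        by (intro ballI) (simp add: c_def coeff_eq_0)
    qed auto
    finally show ?thesis .
  qed
  define C where "C = mat r r (\<lambda>(i, l). c i (r - 1 - l))"
  have "det (mat r r (\<lambda>(i, j). ys ! i ^ (r - 1 - j + lam ! j))) = det C * Delta r lam a" for lam
  proof -
    define D where "D = mat r r (\<lambda>(i, j). a (int (lam ! j) - int j + int i))"
    have "mat r r (\<lambda>(i, j). ys ! i ^ (r - 1 - j + lam ! j)) = C * D"
    proof (rule eq_matI)
      fix i j assume "i < dim_row (C * D)" "j < dim_col (C * D)"
      then have ij: "i < r" "j < r" by (simp_all add: C_def D_def)
      \<comment> \<open>Summation over \<open>r - 1 - l\<close> makes the index of \<open>a\<close>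
        equal to \<open>lam ! j - j + l\<close>, as in \<open>Delta\<close>.\<close>
      have "ys ! i ^ (r - 1 - j + lam ! j) =
          (\<Sum>l<r. c i (r - Suc l) * a (int (r - 1 - j + lam ! j) - int (r - Suc l)))"
        unfolding power[OF ij(1)] by (rule sum.nat_diff_reindex[symmetric])
      also have "\<dots> = (\<Sum>l<r. c i (r - 1 - l) * a (int (lam ! j) - int j + int l))"
        using ij by (intro sum.cong) (auto simp: of_nat_diff intro!: arg_cong2[where f = "(*)"] arg_cong[of _ _ a])
      finally show "mat r r (\<lambda>(i, j). ys ! i ^ (r - 1 - j + lam ! j)) $$ (i, j) = (C * D) $$ (i, j)"
        using ij by (simp add: C_def D_def scalar_prod_def atLeast0LessThan)
    qed (simp_all add: C_def D_def)
    moreover have "det (C * D) = det C * det D"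
      by (rule det_mult[where n = r]) (simp_all add: C_def D_def)
    ultimately show ?thesis by (simp add: Delta_def D_def)
  qed
  then show ?thesis by blast
qed

text \<open>The factor \<open>c\<close> from the factorization is the same for all
  \<open>lam\<close>. At the empty partition \<open>Delta\<close> is 1 and the alternant is the
  Vandermonde determinant, which fixes \<open>c\<close>.\<close>

lemma bialternant:
  fixes ys :: "'a::comm_ring_1 list" and a :: "int \<Rightarrow> 'a"
  defines "r \<equiv> length ys"
  assumes neg: "\<And>j. j < 0 \<Longrightarrow> a j = 0"
    and gen: "Abs_fps (\<lambda>n. a (int n)) * (\<Prod>y\<leftarrow>ys. 1 - fps_const y * fps_X) = 1"
  shows "alternant ys (wedge_indices r lam) = vandermonde_list ys * Delta r lam a"
proof -
  obtain c where c: "\<And>lam. det (mat r r (\<lambda>(i, j). ys ! i ^ (r - 1 - j + lam ! j))) = c * Delta r lam a"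
    using alternant_factorization[OF neg gen] unfolding r_def by blast
  have "fps_nth (\<Prod>y\<leftarrow>ys. 1 - fps_const y * fps_X) 0 = 1"
    by (induction ys) simp_all
  then have "a 0 = 1" using arg_cong[OF gen, of "\<lambda>F. fps_nth F 0"] by simp
  then have "Delta r (empty_partition r) a = 1" using neg by (simp add: Delta_empty)
  then have "c = det (mat r r (\<lambda>(i, j). ys ! i ^ (r - 1 - j + empty_partition r ! j)))"
    using c[of "empty_partition r"] by simp
  also have "\<dots> = det (mat r r (\<lambda>(i, j). ys ! i ^ (r - 1 - j)))"
    by (intro arg_cong[of _ _ det] eq_matI) auto
  finally have "c = vandermonde_list ys" unfolding r_def det_vandermonde .
  moreover have "alternant ys (wedge_indices r lam) =
      det (mat r r (\<lambda>(i, j). ys ! i ^ (r - 1 - j + lam ! j)))"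
    by (subst alternant_det)
      (auto simp: wedge_indices_def r_def intro!: arg_cong[of _ _ det] eq_matI)
  ultimately show ?thesis by (simp only: c)
qed

lemma alternant_staircase:
  "alternant ys (wedge_indices (length ys) (empty_partition (length ys))) = vandermonde_list ys"
  unfolding det_vandermonde[symmetric]
  by (subst alternant_det) (auto simp: wedge_indices_def intro!: arg_cong[of _ _ det] eq_matI)

section \<open>Contraction by geometric covectors\<close>

abbreviation wedge_basis :: "nat list \<Rightarrow> exterior" where
  "wedge_basis ws \<equiv> prod_list (map bvec ws)"

lemma contract_wedge_basis:
  "contract \<beta> (wedge_basis ws) =
     (\<Sum>l<length ws. scale_ext ((- 1) ^ l * lookup \<beta> (ws ! l)) (wedge_basis (take l ws @ drop (Suc l) ws)))"
proof -
  have w: "wedge_basis vs = prod_list (map vect (map (\<lambda>i. single i 1) vs))" for vs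
    by (simp add: bvec_def[abs_def] comp_def)
  show ?thesis
    unfolding w contract_prod_list
    by (intro sum.cong) (simp_all add: pairing_single take_map drop_map)
qed

text \<open>Only finitely many terms are nonzero if all \<open>f j\<close> are additive.\<close>

definition contract_sum_any :: "(nat \<Rightarrow> exterior \<Rightarrow> 'b::ab_group_add) \<Rightarrow> exterior \<Rightarrow> 'b" where
  "contract_sum_any f u = Sum_any (\<lambda>j. f j (contract (single j 1) u))"

text \<open>Three kinds of families occur: \<open>scale_ext (x ^ j)\<close> for evaluation at
  \<open>x\<close>, \<open>bvec j * u\<close> for the Euler operator, and attaching a Laurent
  monomial for contraction by \<open>beta_series\<close>.\<close>

locale additive_family =
  fixes f :: "nat \<Rightarrow> exterior \<Rightarrow> 'b::ab_group_add"
  assumes add: "f j (u + v) = f j u + f j v"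
begin

lemma zero: "f j 0 = 0"
  using add[of j 0 0] by simp

lemma diff: "f j (u - v) = f j u - f j v"
  using add[of j "u - v" v] by (simp add: algebra_simps)

lemma sum: "f j (sum g S) = (\<Sum>i\<in>S. f j (g i))"
  by (induction S rule: infinite_finite_induct) (simp_all add: zero add)

lemma finite_support: "finite {j. f j (contract (single j 1) u) \<noteq> 0}"
  by (rule finite_subset[OF _ finite_contract_beta[of u]]) (auto simp: zero)

lemma contract_sum_any_superset:
  assumes "finite S" "{j. contract (single j 1) u \<noteq> 0} \<subseteq> S"
  shows "contract_sum_any f u = (\<Sum>j\<in>S. f j (contract (single j 1) u))"
  unfolding contract_sum_any_def
  using assms by (intro Sum_any.expand_superset) (auto simp: zero)

lemma contract_sum_any_add: "contract_sum_any f (u + v) = contract_sum_any f u + contract_sum_any f v"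
  unfolding contract_sum_any_def contract_add add
  by (rule Sum_any.distrib) (rule finite_support)+

text \<open>The Kronecker term of the Leibniz rule survives only at \<open>j = i\<close>. In the
  other term \<open>bvec i\<close> stays inside the family, since \<open>f j\<close> need not
  commute with multiplication by it.\<close>

lemma contract_sum_any_bvec_mult:
  "contract_sum_any f (bvec i * u) = f i u - contract_sum_any (\<lambda>j v. f j (bvec i * v)) u"
proof -
  interpret g: additive_family "\<lambda>j v. f j (bvec i * v)"
    by standard (simp add: distrib_left add)
  let ?S = "insert i {j. contract (single j 1) u \<noteq> 0}"
  have fin: "finite ?S" by (simp add: finite_contract_beta)
  have "{j. contract (single j 1) (bvec i * u) \<noteq> 0} \<subseteq> ?S"
    by (auto simp: contract_bvec_mult lookup_single)
  then have "contract_sum_any f (bvec i * u) =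
      (\<Sum>j\<in>?S. f j (scale_ext (lookup (single j 1) i) u - bvec i * contract (single j 1) u))"
    unfolding contract_bvec_mult[symmetric] by (rule contract_sum_any_superset[OF fin])
  also have "\<dots> = (\<Sum>j\<in>?S. (if j = i then f i u else 0)) - (\<Sum>j\<in>?S. f j (bvec i * contract (single j 1) u))"
    unfolding diff sum_subtractf
    by (intro arg_cong2[where f = "(-)"] sum.cong) (auto simp: lookup_single zero)
  also have "(\<Sum>j\<in>?S. (if j = i then f i u else 0)) = f i u"
    using fin by (simp only: sum.delta) simp
  also have "(\<Sum>j\<in>?S. f j (bvec i * contract (single j 1) u)) =
      contract_sum_any (\<lambda>j v. f j (bvec i * v)) u"
    by (rule g.contract_sum_any_superset[symmetric, OF fin]) auto
  finally show ?thesis .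
qed

lemma contract_sum_any_1: "contract_sum_any f 1 = 0"
  by (simp add: contract_sum_any_def contract_1 zero)

lemma contract_sum_any_wedge_basis:
  "contract_sum_any f (wedge_basis ws) =
     (\<Sum>l<length ws. f (ws ! l) (scale_ext ((- 1) ^ l) (wedge_basis (take l ws @ drop (Suc l) ws))))"
proof -
  let ?v = "\<lambda>l. scale_ext ((- 1) ^ l) (wedge_basis (take l ws @ drop (Suc l) ws))"
  have "contract_sum_any f (wedge_basis ws) = (\<Sum>j\<in>set ws. f j (contract (single j 1) (wedge_basis ws)))"
    using contract_beta_not_in by (intro contract_sum_any_superset) auto
  also have "\<dots> = (\<Sum>j\<in>set ws. \<Sum>l<length ws. if j = ws ! l then f (ws ! l) (?v l) else 0)"
    unfolding contract_wedge_basis sum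
    by (intro sum.cong) (auto simp: lookup_single zero)
  also have "\<dots> = (\<Sum>l<length ws. f (ws ! l) (?v l))"
    by (subst sum.swap) (intro sum.cong, auto simp: sum.delta)
  finally show ?thesis .
qed

end

text \<open>Contraction by the covector that takes \<open>bvec i\<close> to \<open>x ^ i\<close>.
  For \<open>x \<noteq> 0\<close> it lies outside the restricted dual, so \<open>contract\<close>
  does not apply to it directly.\<close>

definition contract_geometric :: "rat \<Rightarrow> exterior \<Rightarrow> exterior" where
  "contract_geometric x = contract_sum_any (\<lambda>j. scale_ext (x ^ j))"

interpretation geometric: additive_family "\<lambda>j. scale_ext (x ^ j)" for x
  by standard (rule ext.scale_right_distrib)

lemma contract_geometric_add:
  "contract_geometric x (u + v) = contract_geometric x u + contract_geometric x v"
  by (simp add: contract_geometric_def geometric.contract_sum_any_add)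

lemma contract_geometric_0: "contract_geometric x 0 = 0"
  using contract_geometric_add[of x 0 0] by simp

lemma Sum_any_linear:
  assumes "finite {j. g j \<noteq> 0}" "\<And>x y. h (x + y) = h x + h y"
  shows "(h (Sum_any g) :: 'b::ab_group_add) = Sum_any (\<lambda>j. h (g j :: 'a::ab_group_add))"
proof -
  have 0: "h 0 = 0" using assms(2)[of 0 0] by simp
  have "h (sum g S) = (\<Sum>j\<in>S. h (g j))" for S
    by (induction S rule: infinite_finite_induct) (simp_all add: 0 assms(2))
  then have "h (Sum_any g) = (\<Sum>j\<in>{j. g j \<noteq> 0}. h (g j))" by (simp add: Sum_any.expand_set)
  also have "\<dots> = Sum_any (\<lambda>j. h (g j))"
    using assms(1) by (intro Sum_any.expand_superset[symmetric]) (auto simp: 0)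
  finally show ?thesis .
qed

lemma contract_geometric_scale: "contract_geometric x (scale_ext c u) = scale_ext c (contract_geometric x u)"
proof -
  have "scale_ext c (contract_geometric x u) =
      Sum_any (\<lambda>j. scale_ext c (scale_ext (x ^ j) (contract (single j 1) u)))"
    unfolding contract_geometric_def contract_sum_any_def
    by (rule Sum_any_linear) (simp_all add: geometric.finite_support ext.scale_right_distrib del: ext.scale_eq_0_iff)
  then show ?thesis
    by (simp add: contract_geometric_def contract_sum_any_def contract_scale mult.commute)
qed

lemma contract_geometric_1: "contract_geometric x 1 = 0"
  by (simp add: contract_geometric_def geometric.contract_sum_any_1)

lemma contract_geometric_bvec_mult:
  "contract_geometric x (bvec i * u) = scale_ext (x ^ i) u - bvec i * contract_geometric x u"
proof -
  have "bvec i * contract_geometric x u = Sum_any (\<lambda>j. bvec i * scale_ext (x ^ j) (contract (single j 1) u))"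
    unfolding contract_geometric_def contract_sum_any_def
    by (rule Sum_any_linear) (simp_all add: geometric.finite_support distrib_left del: ext.scale_eq_0_iff)
  then show ?thesis
    unfolding contract_geometric_def geometric.contract_sum_any_bvec_mult
    by (simp add: contract_sum_any_def scale_ext_mult_right)
qed

lemma sigma_bar_0: "sigma_bar n 0 = 0"
  using sigma_bar_scale[of n 0 0] by simp

text \<open>This is where the elementary symmetric polynomials come from: the contraction intertwines
  \<open>\<sigma>\<^sub>+(z)\<close> with \<open>(1 - x z) \<sigma>\<^sub>+(z)\<close>.\<close>

lemma contract_geometric_sigma_bar:
  "contract_geometric x (sigma_bar n u) = sigma_bar n (contract_geometric x u) +
     (if n = 0 then 0 else scale_ext x (sigma_bar (n - 1) (contract_geometric x u)))"
proof (induction u arbitrary: n rule: exterior_induct)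
  case (wedge ws)
  show ?case
  proof (induction ws arbitrary: n)
    case Nil
    then show ?case
      by (simp add: sigma_bar_1 contract_geometric_1 sigma_bar_0 contract_geometric_0)
  next
    case (Cons j ws)
    have minus: "sigma_bar n (u - v) = sigma_bar n u - sigma_bar n v" for n u v
      using sigma_bar_add[of n "u - v" v] by (simp add: algebra_simps)
    show ?case
      by (simp add: sigma_bar_bvec_mult contract_geometric_bvec_mult contract_geometric_add Cons.IH
          minus sigma_bar_scale sigma_bar_0 contract_geometric_0 algebra_simps
          scale_ext_mult_right ext.scale_right_diff_distrib ext.scale_right_distrib)
  qed
qed (simp_all add: sigma_bar_add sigma_bar_scale contract_geometric_add contract_geometric_scale
      ext.scale_right_distrib ac_simps)

section \<open>Evaluation of the exterior algebra at rational points\<close>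

definition counit :: "exterior \<Rightarrow> rat" where
  "counit = (SOME f. Vector_Spaces.linear scale_ext (*) f \<and> f 1 = 1 \<and> (\<forall>u v. f (u * v) = f u * f v) \<and>
     (\<forall>j. f (bvec j) = 0))"

lemma counit_props:
  shows linear_counit: "Vector_Spaces.linear scale_ext (*) counit"
    and counit_1: "counit 1 = 1"
    and counit_mult: "counit (u * v) = counit u * counit v"
    and counit_bvec: "counit (bvec j) = 0"
  using someI_ex[OF counit_exists, folded counit_def] by blast+

lemma counit_add: "counit (u + v) = counit u + counit v"
  and counit_scale: "counit (scale_ext c u) = c * counit u"
  using linear_counit by (simp_all add: Vector_Spaces.linear_iff)

text \<open>The value at \<open>xs\<close> of the alternating polynomial that corresponds to the
  part of \<open>u\<close> of degree \<open>length xs\<close>: each contraction substitutes one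
  entry, and \<open>counit\<close> reads off the remaining constant.\<close>

definition evaluate :: "rat list \<Rightarrow> exterior \<Rightarrow> rat" where
  "evaluate xs u = counit (fold contract_geometric xs u)"

lemma evaluate_Cons: "evaluate (x # xs) u = evaluate xs (contract_geometric x u)"
  by (simp add: evaluate_def)

lemma evaluate_add: "evaluate xs (u + v) = evaluate xs u + evaluate xs v"
  and evaluate_scale: "evaluate xs (scale_ext c u) = c * evaluate xs u"
  by (induction xs arbitrary: u v)
    (simp_all add: evaluate_def counit_add counit_scale contract_geometric_add contract_geometric_scale)

lemma evaluate_0: "evaluate xs 0 = 0"
  using evaluate_add[of xs 0 0] by simp

lemma evaluate_diff: "evaluate xs (u - v) = evaluate xs u - evaluate xs v"
  using evaluate_add[of xs "u - v" v] by simp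

lemma evaluate_sum: "evaluate xs (sum f S) = (\<Sum>i\<in>S. evaluate xs (f i))"
  by (induction S rule: infinite_finite_induct) (simp_all add: evaluate_add evaluate_0)

lemma counit_wedge_basis: "counit (wedge_basis ws) = (if ws = [] then 1 else 0)"
  by (cases ws) (simp_all add: counit_1 counit_mult counit_bvec)

lemma evaluate_wedge_basis: "evaluate xs (wedge_basis ws) = alternant xs ws"
proof (induction xs arbitrary: ws)
  case Nil
  then show ?case by (simp add: evaluate_def counit_wedge_basis)
next
  case (Cons x xs)
  have "evaluate (x # xs) (wedge_basis ws) = (\<Sum>l<length ws. x ^ (ws ! l) * ((- 1) ^ l *
      evaluate xs (wedge_basis (take l ws @ drop (Suc l) ws))))"
    unfolding evaluate_Cons contract_geometric_def geometric.contract_sum_any_wedge_basis evaluate_sum evaluate_scale ..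
  then show ?case unfolding Cons.IH by (simp add: mult_ac)
qed

definition elementary :: "rat list \<Rightarrow> nat \<Rightarrow> rat" where
  "elementary xs n = coeff (\<Prod>x\<leftarrow>xs. [:1, x:]) n"

lemma elementary_Cons:
  "elementary (x # xs) n = elementary xs n + (if n = 0 then 0 else x * elementary xs (n - 1))"
  by (cases n) (simp_all add: elementary_def)

text \<open>Moving the contraction by \<open>x\<close> past \<open>sigma_bar n\<close> produces
  \<open>sigma_bar n\<close> and \<open>x\<close> times \<open>sigma_bar (n - 1)\<close>, which is
  the recursion \<open>elementary_Cons\<close>. With no variables left, \<open>counit\<close> kills
  \<open>sigma_bar n u\<close> for \<open>n > 0\<close>.\<close>

lemma evaluate_sigma_bar: "evaluate xs (sigma_bar n u) = elementary xs n * evaluate xs u"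
proof (induction xs arbitrary: n u)
  case Nil
  have "counit (sigma_bar n u) = (if n = 0 then counit u else 0)"
  proof (induction u rule: exterior_induct)
    case (wedge ws)
    have "sigma_bar 0 v = v" for v
    proof (induction v rule: exterior_induct)
      case (wedge ws)
      show ?case by (induction ws) (simp_all add: sigma_bar_1 sigma_bar_bvec_mult)
    qed (simp_all add: sigma_bar_add sigma_bar_scale)
    then show ?case
      by (cases ws) (simp_all add: sigma_bar_1 sigma_bar_bvec_mult counit_add counit_mult counit_bvec
          counit_wedge_basis counit_scale[of 0 0, simplified])
  qed (simp_all add: sigma_bar_add sigma_bar_scale counit_add counit_scale)
  then show ?case by (simp add: evaluate_def elementary_def)
next
  case (Cons x xs)
  then show ?case
    by (simp add: evaluate_Cons contract_geometric_sigma_bar evaluate_add evaluate_scale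
        evaluate_0 elementary_Cons algebra_simps)
qed

section \<open>Homogeneous elements are determined by their evaluations\<close>

text \<open>All words of length \<open>m\<close> are taken as generators, also unsorted ones and
  those with repeated letters, so that closure under contraction and multiplication is
  immediate.\<close>

definition homogeneous :: "nat \<Rightarrow> exterior set" where
  "homogeneous m = ext.span (wedge_basis ` {ws. length ws = m})"

lemma homogeneous_closed:
  shows homogeneous_0: "0 \<in> homogeneous m"
    and homogeneous_add: "u \<in> homogeneous m \<Longrightarrow> v \<in> homogeneous m \<Longrightarrow> u + v \<in> homogeneous m"
    and homogeneous_diff: "u \<in> homogeneous m \<Longrightarrow> v \<in> homogeneous m \<Longrightarrow> u - v \<in> homogeneous m"
    and homogeneous_scale: "u \<in> homogeneous m \<Longrightarrow> scale_ext c u \<in> homogeneous m"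
    and homogeneous_sum: "(\<And>i. i \<in> S \<Longrightarrow> f i \<in> homogeneous m) \<Longrightarrow> sum f S \<in> homogeneous m"
  unfolding homogeneous_def
  by (simp_all add: ext.span_zero ext.span_add ext.span_diff ext.span_scale ext.span_sum)

lemma homogeneous_wedge_basis: "length ws = m \<Longrightarrow> wedge_basis ws \<in> homogeneous m"
  unfolding homogeneous_def by (intro ext.span_base) blast

lemma homogeneous_induct [consumes 1, case_names wedge zero scale add]:
  assumes "u \<in> homogeneous m"
    and "\<And>ws. length ws = m \<Longrightarrow> P (wedge_basis ws)" and "P 0"
    and "\<And>c u. u \<in> homogeneous m \<Longrightarrow> P u \<Longrightarrow> P (scale_ext c u)"
    and "\<And>u v. u \<in> homogeneous m \<Longrightarrow> v \<in> homogeneous m \<Longrightarrow> P u \<Longrightarrow> P v \<Longrightarrow> P (u + v)"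
  shows "P u"
proof -
  have "u \<in> homogeneous m \<and> P u"
    using assms(1)[unfolded homogeneous_def]
  proof (induction rule: ext.span_induct_alt)
    case base
    show ?case using assms(3) by (simp add: homogeneous_0)
  next
    case (step c x y)
    then obtain ws where "length ws = m" "x = wedge_basis ws" by blast
    then have "x \<in> homogeneous m" "P x"
      using assms(2) homogeneous_wedge_basis by auto
    with step(2) assms(4,5) show ?case by (simp add: homogeneous_add homogeneous_scale)
  qed
  then show ?thesis ..
qed

lemma homogeneous_contract:
  assumes "u \<in> homogeneous (Suc m)"
  shows "contract \<beta> u \<in> homogeneous m"
  using assms
proof (induction rule: homogeneous_induct)
  case (wedge ws)
  then show ?case
    unfolding contract_wedge_basis
    by (intro homogeneous_sum homogeneous_scale homogeneous_wedge_basis) auto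
qed (simp_all add: contract_0 contract_add contract_scale homogeneous_0 homogeneous_add homogeneous_scale)

lemma homogeneous_bvec_mult: "u \<in> homogeneous m \<Longrightarrow> bvec i * u \<in> homogeneous (Suc m)"
proof (induction rule: homogeneous_induct)
  case (wedge ws)
  then show ?case using homogeneous_wedge_basis[of "i # ws" "Suc m"] by simp
qed (simp_all add: distrib_left scale_ext_mult_right homogeneous_0 homogeneous_add homogeneous_scale)

lemma homogeneous_sigma_bar:
  assumes "u \<in> homogeneous m"
  shows "sigma_bar n u \<in> homogeneous m"
  using assms
proof (induction rule: homogeneous_induct)
  case (wedge ws)
  have "sigma_bar n (wedge_basis ws) \<in> homogeneous (length ws)" for n
  proof (induction ws arbitrary: n)
    case Nil
    then show ?case
      using homogeneous_wedge_basis[of "[]" 0] by (simp add: sigma_bar_1 homogeneous_0)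
  next
    case (Cons j ws)
    then show ?case by (simp add: sigma_bar_bvec_mult homogeneous_add homogeneous_bvec_mult)
  qed
  with wedge show ?case by simp
qed (simp_all add: sigma_bar_0 sigma_bar_add sigma_bar_scale homogeneous_0 homogeneous_add homogeneous_scale)

interpretation euler: additive_family "\<lambda>j u. bvec j * u"
  by standard (rule distrib_left)

text \<open>Removing a letter of a word and multiplying it back in front restores the word, once for
  each of its \<open>m\<close> letters. Hence a homogeneous element of positive degree that every
  \<open>\<beta>\<^sub>j\<close> contracts to 0 is itself 0.\<close>

lemma euler_identity:
  assumes "u \<in> homogeneous m"
  shows "contract_sum_any (\<lambda>j u. bvec j * u) u = scale_ext (of_nat m) u"
  using assms
proof (induction rule: homogeneous_induct)
  case (wedge ws)
  have "contract_sum_any (\<lambda>j u. bvec j * u) (wedge_basis ws) = scale_ext (of_nat (length ws)) (wedge_basis ws)"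
  proof (induction ws)
    case Nil
    show ?case using euler.contract_sum_any_1 by simp
  next
    case (Cons i ws)
    \<comment> \<open>The sign from moving \<open>bvec i\<close> to the front cancels the sign of
      the Leibniz rule, so each letter adds 1 to the factor.\<close>
    have anti: "bvec j * (bvec i * v) = - (bvec i * (bvec j * v))" for j v
      using vect_anticommute[of "single j 1" "single i 1"]
      by (simp add: bvec_def flip: mult.assoc)
    have "contract_sum_any (\<lambda>j v. bvec j * (bvec i * v)) v = - (bvec i * contract_sum_any (\<lambda>j u. bvec j * u) v)" for v
    proof -
      have "- (bvec i * contract_sum_any (\<lambda>j u. bvec j * u) v) =
          Sum_any (\<lambda>j. - (bvec i * (bvec j * contract (single j 1) v)))"
        unfolding contract_sum_any_def
        by (rule Sum_any_linear[where h = "\<lambda>u. - (bvec i * u)"])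
          (simp_all add: euler.finite_support distrib_left)
      then show ?thesis by (simp add: contract_sum_any_def anti)
    qed
    then show ?case
      using Cons by (simp add: euler.contract_sum_any_bvec_mult scale_ext_mult_right ext.scale_left_distrib)
  qed
  with wedge show ?case by simp
next
  case zero
  show ?case by (simp add: contract_sum_any_def contract_0)
next
  case (scale c u)
  have "scale_ext c (contract_sum_any (\<lambda>j u. bvec j * u) u) =
      Sum_any (\<lambda>j. scale_ext c (bvec j * contract (single j 1) u))"
    unfolding contract_sum_any_def
    by (rule Sum_any_linear) (simp_all add: euler.finite_support ext.scale_right_distrib)
  then have "contract_sum_any (\<lambda>j u. bvec j * u) (scale_ext c u) = scale_ext c (contract_sum_any (\<lambda>j u. bvec j * u) u)"
    by (simp add: contract_sum_any_def contract_scale scale_ext_mult_right)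
  with scale show ?case by (simp add: mult.commute)
qed (simp add: euler.contract_sum_any_add ext.scale_right_distrib)

text \<open>As a function of \<open>x\<close>, the evaluation at \<open>x # xs\<close> is a polynomial whose \<open>j\<close>-th coefficient is
  the evaluation of \<open>\<beta>\<^sub>j \<lrcorner> u\<close> at \<open>xs\<close>.\<close>

lemma homogeneous_eq_0:
  assumes "u \<in> homogeneous m" "\<And>xs. length xs = m \<Longrightarrow> evaluate xs u = 0"
  shows "u = 0"
  using assms
proof (induction m arbitrary: u)
  case 0
  from 0(1) have "u = scale_ext (counit u) 1"
    by (induction rule: homogeneous_induct)
      (simp_all add: counit_1 counit_scale counit_add ext.scale_left_distrib
        counit_scale[of 0 0, simplified] flip: ext.scale_scale)
  moreover have "counit u = 0" using 0(2)[of "[]"] by (simp add: evaluate_def)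
  ultimately show ?case by simp
next
  case (Suc m)
  have "contract (single j 1) u = 0" for j
  proof (rule Suc.IH)
    fix xs :: "rat list" assume xs: "length xs = m"
    define S where "S = {j. contract (single j 1) u \<noteq> 0}"
    have S: "finite S" unfolding S_def by (rule finite_contract_beta)
    define p where "p = (\<Sum>j\<in>S. Polynomial.monom (evaluate xs (contract (single j 1) u)) j)"
    have "poly p x = 0" for x
    proof -
      have "poly p x = evaluate xs (contract_geometric x u)"
        unfolding contract_geometric_def geometric.contract_sum_any_superset[OF S, unfolded S_def, OF order.refl] evaluate_sum evaluate_scale
        by (simp add: p_def poly_sum poly_monom mult.commute S_def)
      with Suc.prems(2)[of "x # xs"] xs show ?thesis by (simp add: evaluate_Cons)
    qed
    \<comment> \<open>Every rational number is a root of \<open>p\<close>, so all its coefficients,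
      the evaluations of the contractions at \<open>xs\<close>, are 0.\<close>
    then have "p = 0" using poly_all_0_iff_0 by blast
    then have "coeff p j = 0" by simp
    moreover have "coeff p j = (if j \<in> S then evaluate xs (contract (single j 1) u) else 0)"
      using S by (simp add: p_def coeff_sum)
    ultimately show "evaluate xs (contract (single j 1) u) = 0"
      by (cases "j \<in> S") (simp_all add: S_def evaluate_0)
  qed (use Suc.prems(1) in \<open>rule homogeneous_contract\<close>)
  \<comment> \<open>All contractions of \<open>u\<close> vanish, so the Euler identity gives
    \<open>(m + 1) u = 0\<close>, and \<open>m + 1\<close> is invertible in the rationals.\<close>
  then have "contract_sum_any (\<lambda>j u. bvec j * u) u = 0" by (simp add: contract_sum_any_def)
  then have "scale_ext (of_nat (Suc m)) u = 0" by (simp only: euler_identity[OF Suc.prems(1)])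
  then show ?case by (simp del: of_nat_Suc)
qed

section \<open>The action of \<open>B\<^sub>m\<close>\<close>

lemma sigma_bar_funpow_add: "(sigma_bar i ^^ n) (u + v) = (sigma_bar i ^^ n) u + (sigma_bar i ^^ n) v"
  by (induction n) (simp_all add: sigma_bar_add)

lemma monomial_act_add: "monomial_act a (u + v) = monomial_act a u + monomial_act a v"
proof -
  have "foldr (\<lambda>i. sigma_bar i ^^ lookup a i) is (u + v) =
      foldr (\<lambda>i. sigma_bar i ^^ lookup a i) is u + foldr (\<lambda>i. sigma_bar i ^^ lookup a i) is v" for "is"
    by (induction "is") (simp_all add: sigma_bar_funpow_add)
  then show ?thesis by (simp add: monomial_act_def)
qed

lemma B_act_superset:
  assumes "finite K" "keys p \<subseteq> K"
  shows "B_act p u = (\<Sum>a\<in>K. scale_ext (lookup p a) (monomial_act a u))"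
  unfolding B_act_def using assms by (intro sum.mono_neutral_left) (auto simp: in_keys_iff)

lemma B_act_add_left: "B_act (p + q) u = B_act p u + B_act q u"
  using keys_add[of p q]
  by (simp add: B_act_superset[of "keys p \<union> keys q"] lookup_add ext.scale_left_distrib sum.distrib)

lemma B_act_add_right: "B_act p (u + v) = B_act p u + B_act p v"
  by (simp add: B_act_def monomial_act_add ext.scale_right_distrib sum.distrib)

lemma homogeneous_B_act:
  assumes "u \<in> homogeneous m"
  shows "B_act p u \<in> homogeneous m"
proof -
  have pow: "(sigma_bar i ^^ n) v \<in> homogeneous m" if "v \<in> homogeneous m" for i n v
    using that by (induction n) (simp_all add: homogeneous_sigma_bar)
  have "foldr (\<lambda>i. sigma_bar i ^^ lookup a i) is u \<in> homogeneous m" for "is" a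
    using assms by (induction "is") (simp_all add: pow)
  then show ?thesis
    unfolding B_act_def monomial_act_def by (intro homogeneous_sum homogeneous_scale) blast
qed

text \<open>The variable of index \<open>i\<close> takes the value by which
  \<open>sigma_bar i\<close> acts under \<open>evaluate\<close>: this is 1 for index 0 and 0 beyond
  \<open>length xs\<close>.\<close>

definition monomial_eval :: "rat list \<Rightarrow> (nat \<Rightarrow>\<^sub>0 nat) \<Rightarrow> rat" where
  "monomial_eval xs a = (\<Prod>i\<in>keys a. elementary xs i ^ lookup a i)"

definition epoly_eval :: "rat list \<Rightarrow> epoly \<Rightarrow> rat" where
  "epoly_eval xs p = (\<Sum>a\<in>keys p. lookup p a * monomial_eval xs a)"

lemma monomial_eval_add: "monomial_eval xs (a + b) = monomial_eval xs a * monomial_eval xs b"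
proof -
  let ?K = "keys a \<union> keys b"
  have superset: "monomial_eval xs c = (\<Prod>i\<in>?K. elementary xs i ^ lookup c i)" if "keys c \<subseteq> ?K" for c
    unfolding monomial_eval_def using that by (intro prod.mono_neutral_left) (auto simp: in_keys_iff)
  show ?thesis
    using keys_add[of a b] by (simp add: superset lookup_add power_add prod.distrib)
qed

lemma epoly_eval_superset:
  assumes "finite K" "keys p \<subseteq> K"
  shows "epoly_eval xs p = (\<Sum>a\<in>K. lookup p a * monomial_eval xs a)"
  unfolding epoly_eval_def using assms by (intro sum.mono_neutral_left) (auto simp: in_keys_iff)

lemma epoly_eval_single: "epoly_eval xs (single a c) = c * monomial_eval xs a"
  by (subst epoly_eval_superset[of "{a}"]) (auto simp: lookup_single)

lemma epoly_eval_add: "epoly_eval xs (p + q) = epoly_eval xs p + epoly_eval xs q"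
  using keys_add[of p q]
  by (simp add: epoly_eval_superset[of "keys p \<union> keys q"] lookup_add distrib_right sum.distrib)

lemma epoly_eval_mult: "epoly_eval xs (p * q) = epoly_eval xs p * epoly_eval xs q"
proof (induction p rule: poly_mapping_sum_induct)
  case zero
  show ?case by (simp add: epoly_eval_def)
next
  case (mono a c)
  show ?case
  proof (induction q rule: poly_mapping_sum_induct)
    case zero
    show ?case by (simp add: epoly_eval_def)
  qed (simp_all add: mult_single epoly_eval_single monomial_eval_add epoly_eval_add distrib_left)
qed (simp add: epoly_eval_add distrib_right)

interpretation epoly_eval: comm_ring_hom "epoly_eval xs" for xs
proof
  show "epoly_eval xs 0 = 0" by (simp add: epoly_eval_def)
  show "epoly_eval xs 1 = 1"
    using epoly_eval_single[of xs 0 1] by (simp add: monomial_eval_def)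
qed (simp_all add: epoly_eval_add epoly_eval_mult)

lemma evaluate_B_act: "evaluate xs (B_act p u) = epoly_eval xs p * evaluate xs u"
proof -
  have pow: "evaluate xs ((sigma_bar i ^^ n) v) = elementary xs i ^ n * evaluate xs v" for i n v
    by (induction n) (simp_all add: evaluate_sigma_bar)
  have "evaluate xs (foldr (\<lambda>i. sigma_bar i ^^ lookup a i) is u) =
      (\<Prod>i\<leftarrow>is. elementary xs i ^ lookup a i) * evaluate xs u" for "is" a
    by (induction "is") (simp_all add: pow)
  then have "evaluate xs (monomial_act a u) = monomial_eval xs a * evaluate xs u" for a
    by (simp add: monomial_act_def monomial_eval_def prod.distinct_set_conv_list[symmetric])
  then show ?thesis
    by (simp add: B_act_def epoly_eval_def evaluate_sum evaluate_scale sum_distrib_right mult.assoc)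
qed

lemma elementary_eq_0:
  assumes "length xs < n"
  shows "elementary xs n = 0"
  using assms by (induction xs arbitrary: n) (simp_all add: elementary_Cons, simp add: elementary_def)

lemma coeff_Epoly: "coeff (Epoly m) n = (if n \<le> m then (- 1) ^ n * esym n else 0)"
  by (simp add: Epoly_def coeff_sum)

lemma epoly_eval_Epoly:
  assumes "length xs = m"
  shows "epoly_eval xs (coeff (Epoly m) n) = (- 1) ^ n * elementary xs n"
proof -
  have "elementary xs 0 = 1" by (induction xs) (simp_all add: elementary_Cons, simp add: elementary_def)
  then have "epoly_eval xs (esym i) = elementary xs i" for i
    by (simp add: esym_def epoly_eval_single monomial_eval_def)
  with assms show ?thesis
    by (simp add: coeff_Epoly elementary_eq_0 epoly_eval.hom_mult epoly_eval.hom_power epoly_eval.hom_uminus)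
qed

section \<open>Laurent polynomials\<close>

abbreviation map_laurent :: "('a::zero \<Rightarrow> 'b::zero) \<Rightarrow> 'a laurent \<Rightarrow> 'b laurent" where
  "map_laurent \<equiv> Poly_Mapping.map"

lemma lookup_map_laurent: "f 0 = 0 \<Longrightarrow> lookup (map_laurent f P) p = f (lookup P p)"
  by (simp add: Poly_Mapping.map.rep_eq when_def)

lemma map_laurent_single: "f 0 = 0 \<Longrightarrow> map_laurent f (single p c) = single p (f c)"
  by (intro poly_mapping_eqI) (simp add: lookup_map_laurent lookup_single when_def)

lemma map_laurent_add:
  "(\<And>x y. f (x + y) = f x + f y) \<Longrightarrow> f 0 = 0 \<Longrightarrow> map_laurent f (P + Q) = map_laurent f P + map_laurent f Q"
  by (intro poly_mapping_eqI) (simp add: lookup_map_laurent lookup_add)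

lemma map_laurent_0: "map_laurent f 0 = 0"
  by (intro poly_mapping_eqI) (simp add: Poly_Mapping.map.rep_eq)

lemma comm_ring_hom_map_laurent:
  fixes f :: "'a::comm_ring_1 \<Rightarrow> 'b::comm_ring_1"
  assumes "comm_ring_hom f"
  shows "comm_ring_hom (map_laurent f)"
proof -
  interpret f: comm_ring_hom f by (rule assms)
  have add: "map_laurent f (P + Q) = map_laurent f P + map_laurent f Q" for P Q
    by (rule map_laurent_add) (simp_all add: f.hom_add)
  have mult: "map_laurent f (P * Q) = map_laurent f P * map_laurent f Q" for P Q
  proof (induction P rule: poly_mapping_sum_induct)
    case (mono p c)
    show ?case
      by (induction Q rule: poly_mapping_sum_induct)
        (simp_all add: mult_single map_laurent_single map_laurent_0 add f.hom_mult distrib_left)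
  qed (simp_all add: map_laurent_0 add distrib_right)
  show ?thesis
  proof
    show "map_laurent f 1 = 1"
      by (simp add: map_laurent_single flip: single_one)
  qed (simp_all add: add mult map_laurent_0)
qed

interpretation lconst: comm_ring_hom "lconst :: 'a::comm_ring_1 \<Rightarrow> 'a laurent"
  by standard (simp_all add: lconst_def single_add mult_single)

lemma wpow_add: "(wpow i (a + b) :: 'a::comm_ring_1 laurent) = wpow i a * wpow i b"
  by (simp add: wpow_def mult_single single_add)

lemma wpow_0: "wpow i 0 = (1 :: 'a::comm_ring_1 laurent)"
  by (simp add: wpow_def)

lemma wpow_power: "(wpow i a :: 'a::comm_ring_1 laurent) ^ n = wpow i (int n * a)"
  by (induction n) (simp_all add: wpow_0 wpow_add distrib_right)

lemma map_laurent_wpow: "f 0 = 0 \<Longrightarrow> f 1 = 1 \<Longrightarrow> map_laurent f (wpow i n) = wpow i n"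
  by (simp add: wpow_def map_laurent_single)

lemma map_laurent_lconst: "f 0 = 0 \<Longrightarrow> map_laurent f (lconst c) = lconst (f c)"
  by (simp add: lconst_def map_laurent_single)

section \<open>Biadditive maps extended to Laurent polynomials\<close>

locale biadditive =
  fixes f :: "'a::ab_group_add \<Rightarrow> 'b::ab_group_add \<Rightarrow> 'c::ab_group_add"
  assumes add_left: "f (a + a') b = f a b + f a' b" and add_right: "f a (b + b') = f a b + f a b'"
begin

lemma zero_left: "f 0 b = 0" using add_left[of 0 0 b] by simp
lemma zero_right: "f a 0 = 0" using add_right[of a 0 0] by simp

lemma laurent_bilin_superset:
  assumes "finite K" "keys P \<subseteq> K" "finite L" "keys U \<subseteq> L"
  shows "laurent_bilin f P U = (\<Sum>p\<in>K. \<Sum>q\<in>L. single (p + q) (f (lookup P p) (lookup U q)))"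
proof -
  have "laurent_bilin f P U = (\<Sum>p\<in>keys P. \<Sum>q\<in>L. single (p + q) (f (lookup P p) (lookup U q)))"
    unfolding laurent_bilin_def using assms
    by (intro sum.cong sum.mono_neutral_left) (auto simp: in_keys_iff zero_right)
  also have "\<dots> = (\<Sum>p\<in>K. \<Sum>q\<in>L. single (p + q) (f (lookup P p) (lookup U q)))"
    using assms by (intro sum.mono_neutral_left) (auto simp: in_keys_iff zero_left)
  finally show ?thesis .
qed

lemma laurent_bilin_add_left: "laurent_bilin f (P + P') U = laurent_bilin f P U + laurent_bilin f P' U"
  using keys_add[of P P']
  by (simp add: laurent_bilin_superset[of "keys P \<union> keys P'" _ "keys U"] lookup_add add_left
      single_add sum.distrib)

lemma laurent_bilin_add_right: "laurent_bilin f P (U + U') = laurent_bilin f P U + laurent_bilin f P U'"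
  using keys_add[of U U']
  by (simp add: laurent_bilin_superset[of "keys P" _ "keys U \<union> keys U'"] lookup_add add_right
      single_add sum.distrib)

lemma laurent_bilin_single: "laurent_bilin f (single p a) (single q b) = single (p + q) (f a b)"
  by (subst laurent_bilin_superset[of "{p}" _ "{q}"]) (auto simp: lookup_single)

text \<open>By additivity in \<open>P\<close> and \<open>U\<close> it is enough to compare
  monomials. Applied to \<open>scale_ext\<close> and \<open>B_act\<close>, this turns the right-hand
  side of the theorem into a product in a commutative ring.\<close>

lemma map_laurent_bilin:
  fixes g :: "'a \<Rightarrow> 'd::comm_ring_1" and h :: "'b \<Rightarrow> 'd" and h' :: "'c \<Rightarrow> 'd"
  assumes hom: "\<And>a b. h' (f a b) = g a * h b"
    and add: "\<And>x y. g (x + y) = g x + g y" "\<And>x y. h (x + y) = h x + h y" "\<And>x y. h' (x + y) = h' x + h' y"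
  shows "map_laurent h' (laurent_bilin f P U) = map_laurent g P * map_laurent h U"
proof -
  have zero: "g 0 = 0" "h 0 = 0" "h' 0 = 0" using add[of 0 0] by simp_all
  note simps = map_laurent_add[of g, OF add(1) zero(1)] map_laurent_add[of h, OF add(2) zero(2)]
    map_laurent_add[of h', OF add(3) zero(3)] map_laurent_0 map_laurent_single zero hom
    laurent_bilin_add_left laurent_bilin_add_right laurent_bilin_single
  show ?thesis
  proof (induction P rule: poly_mapping_sum_induct)
    case zero
    show ?case by (simp add: laurent_bilin_def map_laurent_0)
  next
    case (mono p c)
    show ?case
    proof (induction U rule: poly_mapping_sum_induct)
      case zero
      show ?case by (simp add: laurent_bilin_def map_laurent_0)
    qed (simp_all add: simps mult_single distrib_left)
  qed (simp add: simps distrib_right)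
qed

end

interpretation scale_ext: biadditive scale_ext
  by standard (simp_all add: ext.scale_left_distrib ext.scale_right_distrib)

interpretation B_act: biadditive B_act
  by standard (simp_all add: B_act_add_left B_act_add_right)

lemma evaluate_scale_laurent:
  "map_laurent (evaluate xs) (scale_laurent P U) = P * map_laurent (evaluate xs) U"
proof -
  have "map_laurent (evaluate xs) (scale_laurent P U) = map_laurent (\<lambda>c. c) P * map_laurent (evaluate xs) U"
    by (rule scale_ext.map_laurent_bilin) (simp_all add: evaluate_scale evaluate_add)
  also have "map_laurent (\<lambda>c. c) P = P"
    by (intro poly_mapping_eqI) (simp add: lookup_map_laurent)
  finally show ?thesis .
qed

lemma evaluate_B_act_laurent:
  "map_laurent (evaluate xs) (B_act_laurent P U) = map_laurent (epoly_eval xs) P * map_laurent (evaluate xs) U"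
  by (rule B_act.map_laurent_bilin) (simp_all add: evaluate_B_act evaluate_add epoly_eval_add)

section \<open>Homogeneous Laurent polynomials and their separation by evaluations\<close>

definition homogeneous_laurent :: "nat \<Rightarrow> exterior laurent set" where
  "homogeneous_laurent m = {U. \<forall>p. lookup U p \<in> homogeneous m}"

lemma homogeneous_laurent_single: "u \<in> homogeneous m \<Longrightarrow> single p u \<in> homogeneous_laurent m"
  by (simp add: homogeneous_laurent_def lookup_single when_def homogeneous_0)

lemma homogeneous_laurent_sum:
  "(\<And>i. i \<in> S \<Longrightarrow> f i \<in> homogeneous_laurent m) \<Longrightarrow> sum f S \<in> homogeneous_laurent m"
  by (simp add: homogeneous_laurent_def lookup_sum homogeneous_sum)

lemma homogeneous_laurent_bilin:
  assumes "U \<in> homogeneous_laurent m" "\<And>c u. u \<in> homogeneous m \<Longrightarrow> f c u \<in> homogeneous m"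
  shows "laurent_bilin f P U \<in> homogeneous_laurent m"
  unfolding laurent_bilin_def using assms
  by (intro homogeneous_laurent_sum homogeneous_laurent_single) (simp add: homogeneous_laurent_def)

text \<open>With \<open>homogeneous_eq_0\<close> applied to each coefficient, equations over
  \<open>exterior\<close> reduce to equations between rational Laurent polynomials.\<close>

lemma homogeneous_laurent_eqI:
  assumes "U \<in> homogeneous_laurent m" "V \<in> homogeneous_laurent m"
    and "\<And>xs. length xs = m \<Longrightarrow> map_laurent (evaluate xs) U = map_laurent (evaluate xs) V"
  shows "U = V"
proof (rule poly_mapping_eqI)
  fix p
  have "lookup U p - lookup V p = 0"
  proof (rule homogeneous_eq_0)
    fix xs :: "rat list" assume "length xs = m"
    then have "lookup (map_laurent (evaluate xs) U) p = lookup (map_laurent (evaluate xs) V) p"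
      by (simp add: assms(3))
    then show "evaluate xs (lookup U p - lookup V p) = 0"
      by (simp add: lookup_map_laurent evaluate_0 evaluate_diff)
  qed (use assms in \<open>simp add: homogeneous_laurent_def homogeneous_diff\<close>)
  then show "lookup U p = lookup V p" by simp
qed

section \<open>Contraction by the series \<open>\<beta>(w\<^sup>-\<^sup>1)\<close>\<close>

lemma contract_series_beta_add:
  "contract_series (beta_series i) (U + V) = contract_series (beta_series i) U + contract_series (beta_series i) V"
proof -
  let ?T = "\<lambda>U p. \<Sum>q\<in>keys U. single (p + q) (contract (beta_series i p) (lookup U q))"
  have superset: "?T W p = (\<Sum>q\<in>keys U \<union> keys V. single (p + q) (contract (beta_series i p) (lookup W q)))"
    if "keys W \<subseteq> keys U \<union> keys V" for W p
    using that by (intro sum.mono_neutral_left) (auto simp: in_keys_iff contract_0)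
  have "?T (U + V) p = ?T U p + ?T V p" for p
    unfolding superset[OF keys_add] superset[OF Un_upper1] superset[OF Un_upper2]
    by (simp add: lookup_add contract_add single_add sum.distrib)
  then show ?thesis
    unfolding contract_series_def
    by (simp only:) (rule Sum_any.distrib; rule finite_contract_beta_series)
qed

text \<open>The exponent vectors in the support of \<open>beta_series i\<close> correspond
  bijectively to the indices \<open>j\<close>, so the sum over exponents becomes a sum over
  \<open>j\<close> to which the wedge formula applies.\<close>

lemma contract_series_beta_single:
  "contract_series (beta_series i) (single q u) = contract_sum_any (\<lambda>j. single (single i (- int j) + q)) u"
proof -
  let ?w = "\<lambda>j. single i (- int j)"
  define S where "S = {j. contract (single j 1) u \<noteq> 0}"
  have S: "finite S" unfolding S_def by (rule finite_contract_beta)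
  have inj: "inj_on ?w S"
    by (rule inj_onI) (metis lookup_single_eq neg_equal_iff_equal of_nat_eq_iff)
  have T: "(\<Sum>q'\<in>keys (single q u). single (p + q') (contract (beta_series i p) (lookup (single q u) q'))) =
      single (p + q) (contract (beta_series i p) u)" for p
    by (cases "u = 0") (simp_all add: contract_0)
  have "contract_series (beta_series i) (single q u) =
      (\<Sum>p\<in>?w ` S. single (p + q) (contract (beta_series i p) u))"
    unfolding contract_series_def T
  proof (rule Sum_any.expand_superset)
    show "{p. single (p + q) (contract (beta_series i p) u) \<noteq> 0} \<subseteq> ?w ` S"
      by (auto simp: beta_series_def S_def contract_zero_covector split: if_splits)
  qed (use S in simp)
  also have "\<dots> = (\<Sum>j\<in>S. single (?w j + q) (contract (single j 1) u))"
    by (simp add: sum.reindex[OF inj] beta_series_single)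
  also have "\<dots> = contract_sum_any (\<lambda>j. single (?w j + q)) u"
    unfolding contract_sum_any_def
    by (intro Sum_any.expand_superset[symmetric] S) (auto simp: S_def)
  finally show ?thesis .
qed

lemma homogeneous_laurent_contract_series:
  assumes "U \<in> homogeneous_laurent (Suc m)"
  shows "contract_series A U \<in> homogeneous_laurent m"
  unfolding contract_series_def Sum_any.expand_set using assms
  by (intro homogeneous_laurent_sum homogeneous_laurent_single homogeneous_contract)
    (simp add: homogeneous_laurent_def)

lemma homogeneous_laurent_contract_wedge:
  assumes "U \<in> homogeneous_laurent (length As + m)"
  shows "contract_wedge As U \<in> homogeneous_laurent m"
  using assms
proof (induction As arbitrary: m)
  case (Cons A As)
  then show ?case
    using Cons.IH[of "Suc m"] by (simp add: contract_wedge_def homogeneous_laurent_contract_series)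
qed (simp add: contract_wedge_def)

lemma alternant_hom:
  assumes "comm_ring_hom f"
  shows "alternant (map f ys) ns = f (alternant ys ns)"
proof -
  interpret comm_ring_hom f by (rule assms)
  show ?thesis
    by (induction ys arbitrary: ns) (simp_all add: hom_sum hom_mult hom_power hom_uminus)
qed

text \<open>Each contraction by \<open>beta_series i\<close> expands one row, with variable
  \<open>wpow i (- 1)\<close>; the evaluation at \<open>xs\<close> expands the rest. The list is
  reversed because \<open>foldr\<close> applies its last entry first, so the rows come in the order
  of \<open>is\<close>.\<close>

lemma evaluate_contract_wedge:
  "map_laurent (evaluate xs) (contract_wedge (map beta_series (rev is)) (lconst (wedge_basis ws))) =
     alternant (map (\<lambda>i. wpow i (- 1)) is @ map lconst xs) ws"
proof -
  define \<Theta> where "\<Theta> is U = map_laurent (evaluate xs) (fold (\<lambda>i. contract_series (beta_series i)) is U)" for "is" U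
  have \<Theta>_add: "\<Theta> is (U + V) = \<Theta> is U + \<Theta> is V" for "is" U V
    by (induction "is" arbitrary: U V)
      (simp_all add: \<Theta>_def contract_series_beta_add map_laurent_add evaluate_add evaluate_0)
  have \<Theta>_0: "\<Theta> is 0 = 0" for "is" using \<Theta>_add[of "is" 0 0] by simp
  have \<Theta>_sum: "\<Theta> is (sum f S) = (\<Sum>i\<in>S. \<Theta> is (f i))" for "is" S and f :: "nat \<Rightarrow> _"
    by (induction S rule: infinite_finite_induct) (simp_all add: \<Theta>_0 \<Theta>_add)
  \<comment> \<open>The induction needs an arbitrary monomial in front, since every contraction
    collects a power of \<open>wpow i (- 1)\<close> in \<open>q\<close> and a sign in
    \<open>c\<close>.\<close>
  have "\<Theta> is (single q (scale_ext c (wedge_basis ws))) =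
      single q c * alternant (map (\<lambda>i. wpow i (- 1)) is @ map lconst xs) ws" for q c
  proof (induction "is" arbitrary: q c ws)
    case Nil
    have "\<Theta> [] (single q (scale_ext c (wedge_basis ws))) = single q c * lconst (alternant xs ws)"
      by (simp add: \<Theta>_def map_laurent_single evaluate_0 evaluate_scale evaluate_wedge_basis lconst_def mult_single)
    then show ?case by (simp add: alternant_hom[OF lconst.comm_ring_hom_axioms])
  next
    case (Cons i "is")
    let ?f = "\<lambda>j v. single (single i (- int j) + q) (scale_ext c v)"
    let ?ys = "map (\<lambda>i. wpow i (- 1)) is @ map lconst xs"
    interpret f: additive_family ?f
      by standard (simp add: ext.scale_right_distrib single_add)
    have "contract_series (beta_series i) (single q (scale_ext c (wedge_basis ws))) =
        contract_sum_any ?f (wedge_basis ws)"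
      by (simp add: contract_series_beta_single contract_sum_any_def contract_scale)
    also have "\<dots> = (\<Sum>l<length ws. single (single i (- int (ws ! l)) + q)
        (scale_ext (c * (- 1) ^ l) (wedge_basis (take l ws @ drop (Suc l) ws))))"
      unfolding f.contract_sum_any_wedge_basis ext.scale_scale ..
    finally have "\<Theta> (i # is) (single q (scale_ext c (wedge_basis ws))) =
        \<Theta> is (\<Sum>l<length ws. single (single i (- int (ws ! l)) + q)
          (scale_ext (c * (- 1) ^ l) (wedge_basis (take l ws @ drop (Suc l) ws))))"
      by (simp add: \<Theta>_def)
    also have "\<dots> = (\<Sum>l<length ws. single (single i (- int (ws ! l)) + q) (c * (- 1) ^ l) *
        alternant ?ys (take l ws @ drop (Suc l) ws))"
      unfolding \<Theta>_sum Cons.IH ..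
    also have "\<dots> = single q c * alternant (wpow i (- 1) # ?ys) ws"
      unfolding alternant.simps sum_distrib_left
    proof (rule sum.cong)
      fix l
      have "(- 1) ^ l = (lconst ((- 1) ^ l) :: rat laurent)"
        by (simp add: lconst.hom_power lconst.hom_uminus)
      then have "single (single i (- int (ws ! l)) + q) (c * (- 1) ^ l) =
          single q c * ((- 1) ^ l * wpow i (- 1) ^ (ws ! l))"
        by (simp add: wpow_power) (simp add: lconst_def wpow_def mult_single add.commute)
      then show "single (single i (- int (ws ! l)) + q) (c * (- 1) ^ l) * alternant ?ys (take l ws @ drop (Suc l) ws) =
          single q c * ((- 1) ^ l * wpow i (- 1) ^ (ws ! l) * alternant ?ys (take l ws @ drop (Suc l) ws))"
        by (simp add: mult.assoc)
    qed simp
    finally show ?case by simp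
  qed
  from this[of 0 1] have "\<Theta> is (lconst (wedge_basis ws)) = alternant (map (\<lambda>i. wpow i (- 1)) is @ map lconst xs) ws"
    by (simp add: lconst_def)
  moreover have "contract_wedge (map beta_series (rev is)) U = fold (\<lambda>i. contract_series (beta_series i)) is U" for U
    by (simp add: contract_wedge_def foldr_map foldr_conv_fold comp_def rev_map fold_map)
  ultimately show ?thesis by (simp add: \<Theta>_def)
qed

section \<open>The coefficient of \<open>\<Gamma>\<^sup>*\<close>\<close>

interpretation eval_laurent: comm_ring_hom "map_laurent (epoly_eval xs)" for xs
  by (rule comm_ring_hom_map_laurent) (rule epoly_eval.comm_ring_hom_axioms)

lemma Elaurent_eval:
  assumes "length xs = m"
  shows "map_laurent (epoly_eval xs) (Elaurent m i) = (\<Prod>x\<leftarrow>xs. 1 - lconst x * wpow i 1)"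
proof -
  define w where "w = (wpow i 1 :: rat laurent)"
  have "Elaurent m i = (\<Sum>n\<le>m. lconst (coeff (Epoly m) n) * wpow i 1 ^ n)"
  proof -
    have "degree (map_poly lconst (Epoly m)) \<le> m"
      by (rule degree_le) (simp add: coeff_map_poly coeff_Epoly)
    then have "Elaurent m i = (\<Sum>n\<le>m. coeff (map_poly lconst (Epoly m)) n * wpow i 1 ^ n)"
      unfolding Elaurent_def poly_altdef
      by (intro sum.mono_neutral_left) (auto simp: coeff_eq_0)
    then show ?thesis by (simp add: coeff_map_poly)
  qed
  then have "map_laurent (epoly_eval xs) (Elaurent m i) =
      (\<Sum>n\<le>m. lconst (epoly_eval xs (coeff (Epoly m) n)) * w ^ n)"
    by (simp add: eval_laurent.hom_sum eval_laurent.hom_mult eval_laurent.hom_power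
        map_laurent_lconst map_laurent_wpow w_def)
  also have "\<dots> = (\<Sum>n\<le>m. lconst ((- 1) ^ n * elementary xs n) * w ^ n)"
    by (simp add: epoly_eval_Epoly[OF assms])
  \<comment> \<open>The bound \<open>N\<close> is free above \<open>length xs\<close> because the
    induction step uses the hypothesis at both \<open>N\<close> and \<open>N - 1\<close>.\<close>
  also have "(\<Sum>n\<le>N. lconst ((- 1) ^ n * elementary xs n) * w ^ n) = (\<Prod>x\<leftarrow>xs. 1 - lconst x * w)"
    if "length xs \<le> N" for N
    using that
  proof (induction xs arbitrary: N)
    case Nil
    have "(\<Sum>n\<le>N. lconst ((- 1) ^ n * elementary [] n) * w ^ n) = (\<Sum>n\<le>N. if n = 0 then 1 else 0)"
      by (rule sum.cong) (auto simp: elementary_def)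
    then show ?case by simp
  next
    case (Cons x xs)
    then obtain N' where N: "N = Suc N'" "length xs \<le> N'" by (cases N) auto
    have "(\<Sum>n\<le>N. lconst ((- 1) ^ n * elementary (x # xs) n) * w ^ n) =
        (\<Sum>n\<le>N. lconst ((- 1) ^ n * elementary xs n) * w ^ n) +
        (\<Sum>n\<le>N. if n = 0 then 0 else lconst ((- 1) ^ n * (x * elementary xs (n - 1))) * w ^ n)"
      unfolding sum.distrib[symmetric]
      by (rule sum.cong) (auto simp: elementary_Cons distrib_left distrib_right lconst.hom_add)
    also have "(\<Sum>n\<le>N. if n = 0 then 0 else lconst ((- 1) ^ n * (x * elementary xs (n - 1))) * w ^ n) =
        - (lconst x * w) * (\<Sum>n\<le>N'. lconst ((- 1) ^ n * elementary xs n) * w ^ n)"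
      unfolding N sum.atMost_Suc_shift sum_distrib_left
      by (simp add: lconst.hom_mult lconst.hom_uminus mult_ac flip: sum_negf)
    finally show ?case
      using Cons.IH[of N] Cons.IH[of N'] Cons.prems N by (simp add: algebra_simps)
  qed
  finally show ?thesis using assms by (simp add: w_def)
qed

lemma fps_elementary:
  "Abs_fps (\<lambda>n. lconst ((- 1) ^ n * elementary xs n)) = (\<Prod>x\<leftarrow>xs. 1 - fps_const (lconst x) * fps_X)"
proof (induction xs)
  case Nil
  show ?case by (rule fps_ext) (simp add: elementary_def)
next
  case (Cons x xs)
  have "Abs_fps (\<lambda>n. lconst ((- 1) ^ n * elementary (x # xs) n)) =
      (1 - fps_const (lconst x) * fps_X) * Abs_fps (\<lambda>n. lconst ((- 1) ^ n * elementary xs n))"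
  proof (rule fps_ext)
    fix n
    show "fps_nth (Abs_fps (\<lambda>n. lconst ((- 1) ^ n * elementary (x # xs) n))) n =
      fps_nth ((1 - fps_const (lconst x) * fps_X) * Abs_fps (\<lambda>n. lconst ((- 1) ^ n * elementary xs n))) n"
      by (cases n) (simp_all add: elementary_Cons left_diff_distrib mult.assoc distrib_left
          lconst.hom_add lconst.hom_mult lconst.hom_uminus mult_ac)
  qed
  with Cons show ?case by simp
qed

lemma sigma_minus_H_Suc: "sigma_minus_H (Suc k) m = sigma_minus (Suc k) (sigma_minus_H k m)"
  by (simp add: sigma_minus_H_def)

lemma sigma_minus_H_neg: "j < 0 \<Longrightarrow> sigma_minus_H k m j = 0"
proof (induction k arbitrary: j)
  case 0
  then show ?case by (simp add: sigma_minus_H_def hseq_def)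
next
  case (Suc k)
  then show ?case by (simp add: sigma_minus_H_Suc sigma_minus_eq)
qed

text \<open>For \<open>k = 0\<close> this is \<open>Epoly_mult_hseq\<close> after evaluation. Every
  further \<open>sigma_minus\<close> multiplies the generating function by a geometric series, which
  adds the variable \<open>wpow (Suc k) (- 1)\<close>. The result is the hypothesis of
  \<open>bialternant\<close>.\<close>

lemma sigma_minus_H_generating_function:
  assumes "length xs = m"
  shows "Abs_fps (\<lambda>n. map_laurent (epoly_eval xs) (sigma_minus_H k m (int n))) *
    (\<Prod>y\<leftarrow>map (\<lambda>i. wpow i (- 1)) [1..<Suc k] @ map lconst xs. 1 - fps_const y * fps_X) = 1"
proof (induction k)
  case 0
  let ?h = "\<lambda>n. epoly_eval xs (hseq m (int n))"
  have "Abs_fps (\<lambda>n. lconst ((- 1) ^ n * elementary xs n)) * Abs_fps (\<lambda>n. lconst (?h n)) = 1"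
  proof (rule fps_ext)
    fix n
    have "(\<Sum>i = 0..n. coeff (Epoly m) i * hseq m (int (n - i))) = (if n = 0 then 1 else 0)"
      using arg_cong[OF Epoly_mult_hseq, of "\<lambda>f. fps_nth f n"] by (simp add: fps_mult_nth)
    from arg_cong[OF this, of "epoly_eval xs"]
    have "(\<Sum>i = 0..n. (- 1) ^ i * elementary xs i * ?h (n - i)) = (if n = 0 then 1 else 0)"
      by (simp add: epoly_eval.hom_sum epoly_eval.hom_mult epoly_eval_Epoly[OF assms] split: if_splits)
    from arg_cong[OF this, of lconst]
    show "fps_nth (Abs_fps (\<lambda>n. lconst ((- 1) ^ n * elementary xs n)) * Abs_fps (\<lambda>n. lconst (?h n))) n =
        fps_nth 1 n"
      by (simp add: fps_mult_nth lconst.hom_sum lconst.hom_mult split: if_splits)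
  qed
  then show ?case
    unfolding fps_elementary by (simp add: sigma_minus_H_def map_laurent_lconst mult.commute comp_def)
next
  case (Suc k)
  let ?a = "\<lambda>k n. map_laurent (epoly_eval xs) (sigma_minus_H k m (int n))"
  let ?w = "wpow (Suc k) (- 1) :: rat laurent"
  have "Abs_fps (?a (Suc k)) = Abs_fps (?a k) * Abs_fps (\<lambda>n. ?w ^ n)"
  proof (rule fps_ext)
    fix n
    have "?a (Suc k) n = (\<Sum>i\<le>n. ?a k (n - i) * ?w ^ i)"
      by (simp add: sigma_minus_H_Suc sigma_minus_eq[OF sigma_minus_H_neg] eval_laurent.hom_sum
          eval_laurent.hom_mult map_laurent_wpow wpow_power of_nat_diff)
    also have "\<dots> = (\<Sum>i\<le>n. ?a k i * ?w ^ (n - i))"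
      by (rule sum.reindex_bij_witness[of _ "\<lambda>i. n - i" "\<lambda>i. n - i"]) auto
    finally show "fps_nth (Abs_fps (?a (Suc k))) n = fps_nth (Abs_fps (?a k) * Abs_fps (\<lambda>n. ?w ^ n)) n"
      by (simp add: fps_mult_nth atLeast0AtMost)
  qed
  then have "Abs_fps (?a (Suc k)) * (1 - fps_const ?w * fps_X) = Abs_fps (?a k)"
    by (simp add: mult.assoc geometric_fps)
  moreover have "(\<Prod>y\<leftarrow>map (\<lambda>i. wpow i (- 1)) [1..<Suc (Suc k)] @ map lconst xs. 1 - fps_const y * fps_X) =
      (1 - fps_const ?w * fps_X) *
      (\<Prod>y\<leftarrow>map (\<lambda>i. wpow i (- 1)) [1..<Suc k] @ map lconst xs. 1 - fps_const y * fps_X)"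
    by (subst upt_Suc_append) (simp_all add: mult_ac del: upt_Suc)
  ultimately show ?case using Suc.IH by (simp only: mult.assoc[symmetric])
qed

section \<open>Determinants and Vandermonde products under ring homomorphisms\<close>

lemma Delta_eval:
  "map_laurent (epoly_eval xs) (Delta r lam a) = Delta r lam (\<lambda>j. map_laurent (epoly_eval xs) (a j))"
  unfolding Delta_def eval_laurent.hom_det[symmetric]
  by (intro arg_cong[of _ _ det] eq_matI) auto

lemma vandermonde_list_hom:
  assumes "comm_ring_hom f"
  shows "vandermonde_list (map f ys) = f (vandermonde_list ys)"
proof -
  interpret comm_ring_hom f by (rule assms)
  show ?thesis
    by (induction ys) (simp_all add: hom_mult hom_prod_list hom_minus comp_def)
qed

lemma prod_list_upt: "(\<Prod>i\<leftarrow>[1..<Suc k]. f i) = (\<Prod>i = 1..k. f i :: 'a::comm_monoid_mult)"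
  by (induction k) (simp_all add: mult.commute)

text \<open>For \<open>i < j\<close> the difference of the inverses of \<open>w_i\<close> and
  \<open>w_j\<close> is \<open>w_j - w_i\<close> divided by \<open>w_i w_j\<close>, without a sign.
  Every variable occurs in \<open>k - 1\<close> pairs, hence the exponent.\<close>

lemma vandermonde_list_wpow:
  "vandermonde_list (map (\<lambda>i. wpow i (- 1)) [1..<Suc k]) = vandermonde k * (\<Prod>i = 1..k. wpow i (- 1)) ^ (k - 1)"
proof (induction k)
  case (Suc k)
  let ?v = "\<lambda>i. wpow i (- 1) :: rat laurent" and ?w = "\<lambda>i. wpow i 1 :: rat laurent"
  have inv: "?v i * ?w i = 1" for i by (simp add: wpow_0 flip: wpow_add)
  have diff: "?v i - ?v j = ?v i * ?v j * (?w j - ?w i)" for i j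
  proof -
    have "?v i * ?v j * (?w j - ?w i) = ?v i * (?v j * ?w j) - ?v j * (?v i * ?w i)"
      by (simp add: algebra_simps)
    then show ?thesis by (simp add: inv)
  qed
  have "vandermonde_list (map ?v [1..<Suc (Suc k)]) =
      vandermonde k * (\<Prod>i = 1..k. ?v i) ^ (k - 1) * (\<Prod>i = 1..k. ?v i - ?v (Suc k))"
    using Suc.IH prod_list_upt[where k = k and f = "\<lambda>i. ?v i - ?v (Suc k)"]
    by (simp add: vandermonde_list_append comp_def)
  also have "(\<Prod>i = 1..k. ?v i - ?v (Suc k)) = (\<Prod>i = 1..k. ?v i) * ?v (Suc k) ^ k * (\<Prod>i = 1..k. ?w (Suc k) - ?w i)"
    unfolding diff prod.distrib by simp
  also have "vandermonde k * (\<Prod>i = 1..k. ?v i) ^ (k - 1) * \<dots> =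
      vandermonde (Suc k) * (\<Prod>i = 1..Suc k. ?v i) ^ (Suc k - 1)"
    \<comment> \<open>The case \<open>k = 0\<close> is separate because \<open>k - 1\<close> is
      truncated there.\<close>
    by (cases k) (simp_all add: vandermonde_def power_mult_distrib mult_ac atLeastLessThanSuc_atLeastAtMost)
  finally show ?case .
qed (simp add: vandermonde_def)

theorem theorem6p3:
  fixes k r :: nat and lam :: "nat list"
  assumes "1 \<le> k" and "k \<le> r" and "lam \<in> partitions_le r"
  shows "contract_wedge (map beta_series (rev [1..<Suc k])) (lconst (bwedge r lam)) =
    scale_laurent (vandermonde k * (\<Prod>i = 1..k. wpow i (- 1)) ^ (r - 1))
      (Gamma_star k r (bwedge r lam))"
proof -
  define m where "m = r - k"
  have r: "r = k + m" using assms(2) by (simp add: m_def)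
  have bwedge_homogeneous: "lconst (bwedge n mu) \<in> homogeneous_laurent n" for n mu
    unfolding bwedge_eq lconst_def
    by (intro homogeneous_laurent_single homogeneous_wedge_basis) (simp add: wedge_indices_def)
  show ?thesis
    unfolding Gamma_star_bwedge[OF assms(3)] m_def[symmetric]
  \<comment> \<open>Both sides are homogeneous of degree \<open>m\<close>, so it suffices to compare
    their evaluations at all lists of \<open>m\<close> rationals.\<close>
  proof (rule homogeneous_laurent_eqI)
    show "contract_wedge (map beta_series (rev [1..<Suc k])) (lconst (bwedge r lam)) \<in> homogeneous_laurent m"
      by (rule homogeneous_laurent_contract_wedge) (use bwedge_homogeneous[of r] assms(1) in \<open>simp add: r\<close>)
    show "scale_laurent (vandermonde k * (\<Prod>i = 1..k. wpow i (- 1)) ^ (r - 1))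
        (B_act_laurent (Gamma_star_coeff k r lam) (lconst (bwedge m (empty_partition m)))) \<in> homogeneous_laurent m"
      by (intro homogeneous_laurent_bilin bwedge_homogeneous homogeneous_scale homogeneous_B_act)
  next
    fix xs :: "rat list" assume xs: "length xs = m"
    let ?v = "\<lambda>i. wpow i (- 1) :: rat laurent"
    define ys where "ys = map ?v [1..<Suc k] @ map lconst xs"
    define a where "a j = map_laurent (epoly_eval xs) (sigma_minus_H k m j)" for j
    define E where "E i = (\<Prod>x\<leftarrow>xs. 1 - lconst x * wpow i 1 :: rat laurent)" for i
    have ys: "length ys = r" by (simp add: ys_def r xs)
    have "map_laurent (evaluate xs) (contract_wedge (map beta_series (rev [1..<Suc k])) (lconst (bwedge r lam))) =
        alternant ys (wedge_indices r lam)"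
      unfolding bwedge_eq evaluate_contract_wedge ys_def ..
    also have "\<dots> = vandermonde_list ys * Delta r lam a"
      unfolding ys[symmetric] using sigma_minus_H_generating_function[OF xs, of k]
      by (intro bialternant) (simp_all add: a_def ys_def sigma_minus_H_neg)
    \<comment> \<open>The product splits into pairs of inverse \<open>w\<close> variables, mixed
      pairs, and pairs from \<open>xs\<close>.\<close>
    also have "vandermonde_list ys = vandermonde k * (\<Prod>i = 1..k. ?v i) ^ (r - 1) * (\<Prod>i = 1..k. E i) *
        lconst (vandermonde_list xs)"
    proof -
      \<comment> \<open>Pulling \<open>?v i\<close> out of the \<open>m\<close> mixed factors leaves
        the evaluation of \<open>Elaurent m i\<close>.\<close>
      have "(\<Prod>x\<leftarrow>xs. ?v i - lconst x) = ?v i ^ m * E i" for i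
      proof -
        have "?v i - lconst x = ?v i * (1 - lconst x * wpow i 1)" for x
        proof -
          have "?v i * wpow i 1 = 1" by (simp add: wpow_0 flip: wpow_add)
          then show ?thesis by (simp add: right_diff_distrib mult.left_commute)
        qed
        then have "(\<Prod>x\<leftarrow>zs. ?v i - lconst x) = ?v i ^ length zs * (\<Prod>x\<leftarrow>zs. 1 - lconst x * wpow i 1)" for zs
          by (induction zs) (simp_all add: mult_ac)
        then show ?thesis by (simp add: E_def xs)
      qed
      then have "(\<Prod>y\<leftarrow>map ?v [1..<Suc k]. \<Prod>x\<leftarrow>map lconst xs. y - x) = (\<Prod>i = 1..k. ?v i) ^ m * (\<Prod>i = 1..k. E i)"
        using prod_list_upt[where k = k and f = "\<lambda>i. \<Prod>x\<leftarrow>xs. ?v i - lconst x"]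
        by (simp add: comp_def prod.distrib prod_power_distrib)
      \<comment> \<open>The summand \<open>k - 1\<close> comes from the pairs of \<open>w\<close>
        variables and \<open>m\<close> from the mixed pairs; the truncated subtraction requires
        \<open>1 \<le> k\<close>.\<close>
      moreover have "r - 1 = k - 1 + m" using assms(1) by (simp add: r)
      ultimately show ?thesis
        unfolding ys_def vandermonde_list_append vandermonde_list_wpow
          vandermonde_list_hom[OF lconst.comm_ring_hom_axioms]
        by (simp add: power_add mult_ac)
    qed
    \<comment> \<open>The Vandermonde determinant of \<open>xs\<close> is the evaluation of the
      generator on which \<open>Gamma_star_coeff\<close> acts.\<close>
    also have "lconst (vandermonde_list xs) = map_laurent (evaluate xs) (lconst (bwedge m (empty_partition m)))"
      using alternant_staircase[of xs]
      by (simp add: map_laurent_lconst evaluate_0 bwedge_eq evaluate_wedge_basis xs)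
    also have "vandermonde k * (\<Prod>i = 1..k. ?v i) ^ (r - 1) * (\<Prod>i = 1..k. E i) * \<dots> * Delta r lam a =
        map_laurent (evaluate xs) (scale_laurent (vandermonde k * (\<Prod>i = 1..k. ?v i) ^ (r - 1))
          (B_act_laurent (Gamma_star_coeff k r lam) (lconst (bwedge m (empty_partition m)))))"
      by (simp add: evaluate_scale_laurent evaluate_B_act_laurent Gamma_star_coeff_def eval_laurent.hom_mult
          eval_laurent.hom_prod Delta_eval Elaurent_eval xs a_def[symmetric] E_def[symmetric]
          m_def[symmetric] mult_ac)
    finally show "map_laurent (evaluate xs) (contract_wedge (map beta_series (rev [1..<Suc k])) (lconst (bwedge r lam))) =
        map_laurent (evaluate xs) (scale_laurent (vandermonde k * (\<Prod>i = 1..k. ?v i) ^ (r - 1))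
          (B_act_laurent (Gamma_star_coeff k r lam) (lconst (bwedge m (empty_partition m)))))" .
  qed
qed

end
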